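(* Let $r\in\mathbb{N}$ with $r\ge3$ and let $d=\binom{r+2}{3}+r+3$. The ideal $$J=x^2(x,y,z)^{r-2}+xy(y,z)^{r-2}+(xz^r)+y(y,z)^r+(z^{r+2})\subseteq S=k[x,y,z]$$ satisfies $[J]\in\mathrm{Hilb}^d\mathbb{A}^3$ (that is, $\dim_k(S/J)=d$) and $$\dim_kT(J)>\dim_kT(E(d)).$$
   Context: $k$ is an infinite field, $S=k[x,y,z]$, $\mathfrak{m}=(x,y,z)$. $\mathrm{Hilb}^d\mathbb{A}^3$ is the Hilbert scheme of $d$ points in $\mathbb{A}^3=\mathrm{Spec}\,S$, with $k$-points $[I]$ corresponding to ideals $I\subseteq S$ with $\dim_k(S/I)=d$; the tangent space at $[I]$ is $T(I)=\mathrm{Hom}_S(I,S/I)$. For each $d\in\mathbb{N}$, $E(d)\subseteq S$ denotes the unique lexsegment ideal with $\dim_k(S/E(d))=d$ and $\mathfrak{m}^{s+1}\subseteq E(d)\subseteq\mathfrak{m}^{s}$ for some $s$; that is, $E(d)=K+\mathfrak{m}^{s+1}$ where $K$ is generated by an initial segment (the largest monomials) of the monomials of degree $s$ in the lexicographic order with $x>y>z$. In the expression for $J$, notation such as $x^2(x,y,z)^{r-2}$ denotes the ideal of $S$ generated by the products of $x^2$ with the degree $r-2$ monomials in $x,y,z$, and similarly $xy(y,z)^{r-2}$ and $y(y,z)^r$ denote ideals of $S$ generated by the corresponding products with monomials in $y,z$. *)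

theory Defs
  imports
    "HOL-Algebra.QuotRing"
    "HOL-Algebra.Ideal_Product"
    "HOL-Algebra.Algebraic_Closure_Type"
    "HOL-Library.Poly_Mapping"
    "HOL-Library.Product_Plus"
    "Jordan_Normal_Form.Missing_VectorSpace"
begin

section \<open>The polynomial ring \<open>S = k[x,y,z]\<close>\<close>

text \<open>A polynomial is a finitely supported function on exponent vectors; \<open>Poly_Mapping\<close> equips
  this type with the convolution product, i.e. the monoid algebra of \<open>(\<nat>\<^sup>3, +)\<close> over \<open>k\<close>.\<close>

type_synonym 'k poly3 = "(nat \<times> nat \<times> nat) \<Rightarrow>\<^sub>0 'k"

abbreviation kk :: "'k::field ring"
  where "kk \<equiv> ring_of_type_algebra"

abbreviation SS :: "'k::field poly3 ring"
  where "SS \<equiv> ring_of_type_algebra"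

definition const3 :: "'k::field \<Rightarrow> 'k poly3"
  where "const3 c = Poly_Mapping.single 0 c"

text \<open>\<open>mono3 a b c\<close> is \<open>x\<^sup>a y\<^sup>b z\<^sup>c\<close>.\<close>

definition mono3 :: "nat \<Rightarrow> nat \<Rightarrow> nat \<Rightarrow> 'k::field poly3"
  where "mono3 a b c = Poly_Mapping.single (a, b, c) 1"

definition mm :: "'k::field poly3 set"
  where "mm = Idl\<^bsub>SS\<^esub> {mono3 1 0 0, mono3 0 1 0, mono3 0 0 1}"

section \<open>Modules\<close>

text \<open>Module records extend ring records, but the fields \<open>mult\<close> and \<open>one\<close> play no role in the
  module axioms; below they are filled with arbitrary values.\<close>

definition ideal_mod :: "('a, 'm) ring_scheme \<Rightarrow> 'a set \<Rightarrow> ('a, 'a) module"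
  where "ideal_mod R I =
    \<lparr>carrier = I, monoid.mult = monoid.mult R, one = \<one>\<^bsub>R\<^esub>, zero = \<zero>\<^bsub>R\<^esub>, add = add R,
     module.smult = monoid.mult R\<rparr>"

definition quot_mod :: "('a, 'm) ring_scheme \<Rightarrow> 'a set \<Rightarrow> ('a, 'a set) module"
  where "quot_mod R I =
    \<lparr>carrier = carrier (R Quot I), monoid.mult = monoid.mult (R Quot I), one = \<one>\<^bsub>R Quot I\<^esub>,
     zero = \<zero>\<^bsub>R Quot I\<^esub>, add = add (R Quot I),
     module.smult = (\<lambda>a U. (I +>\<^bsub>R\<^esub> a) \<otimes>\<^bsub>R Quot I\<^esub> U)\<rparr>"

text \<open>\<open>module_hom\<close> says nothing about values outside the carrier of \<open>M\<close>; intersecting with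
  \<open>extensional\<close> makes equality of homomorphisms agree with equality on \<open>M\<close>.\<close>

definition hom_mod ::
    "('a, 'm) ring_scheme \<Rightarrow> ('a, 'b, 'n) module_scheme \<Rightarrow> ('a, 'c, 'p) module_scheme
      \<Rightarrow> ('a, 'b \<Rightarrow> 'c) module"
  where "hom_mod R M N =
    \<lparr>carrier = LinearCombinations.module_hom R M N \<inter> extensional (carrier M),
     monoid.mult = (\<lambda>f g. \<lambda>v\<in>carrier M. \<zero>\<^bsub>N\<^esub>),
     one = (\<lambda>v\<in>carrier M. \<zero>\<^bsub>N\<^esub>),
     zero = (\<lambda>v\<in>carrier M. \<zero>\<^bsub>N\<^esub>),
     add = (\<lambda>f g. \<lambda>v\<in>carrier M. f v \<oplus>\<^bsub>N\<^esub> g v),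
     module.smult = (\<lambda>a f. \<lambda>v\<in>carrier M. a \<odot>\<^bsub>N\<^esub> f v)\<rparr>"

definition restrict_scalars :: "('c \<Rightarrow> 'a) \<Rightarrow> ('a, 'b, 'm) module_scheme \<Rightarrow> ('c, 'b) module"
  where "restrict_scalars \<phi> M =
    \<lparr>carrier = carrier M, monoid.mult = monoid.mult M, one = \<one>\<^bsub>M\<^esub>, zero = \<zero>\<^bsub>M\<^esub>, add = add M,
     module.smult = (\<lambda>c v. \<phi> c \<odot>\<^bsub>M\<^esub> v)\<rparr>"

section \<open>Points of the Hilbert scheme and their tangent spaces\<close>

definition quot_space :: "'k::field poly3 set \<Rightarrow> ('k, 'k poly3 set) module"
  where "quot_space I = restrict_scalars const3 (quot_mod SS I)"

text \<open>The \<open>k\<close>-points of \<open>Hilb\<^sup>d \<bbbA>\<^sup>3\<close>. Finite-dimensionality is stated separately because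
  \<open>vectorspace.dim\<close> is a \<open>LEAST\<close> without a witness on infinite-dimensional spaces.\<close>

definition hilb3 :: "nat \<Rightarrow> 'k::field poly3 set set"
  where "hilb3 d = {I. ideal I SS \<and> vectorspace.fin_dim kk (quot_space I)
    \<and> vectorspace.dim kk (quot_space I) = d}"

definition tangent_space :: "'k::field poly3 set \<Rightarrow> ('k, 'k poly3 \<Rightarrow> 'k poly3 set) module"
  where "tangent_space I =
    restrict_scalars const3 (hom_mod SS (ideal_mod SS I) (quot_mod SS I))"

section \<open>Lexsegment ideals\<close>

text \<open>\<open>(m, m') \<in> lex3\<close> iff the monomial with exponent \<open>m\<close> is lexicographically smaller than the
  one with exponent \<open>m'\<close>, where \<open>x > y > z\<close>.\<close>

definition lex3 :: "((nat \<times> nat \<times> nat) \<times> (nat \<times> nat \<times> nat)) set"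
  where "lex3 = less_than <*lex*> less_than <*lex*> less_than"

definition exps3 :: "nat \<Rightarrow> (nat \<times> nat \<times> nat) set"
  where "exps3 s = {(a, b, c). a + b + c = s}"

definition lex_initial :: "nat \<Rightarrow> (nat \<times> nat \<times> nat) set \<Rightarrow> bool"
  where "lex_initial s K \<longleftrightarrow>
    K \<subseteq> exps3 s \<and> (\<forall>m\<in>K. \<forall>m'\<in>exps3 s. (m, m') \<in> lex3 \<longrightarrow> m' \<in> K)"

definition lexseg_ideal :: "'k::field poly3 set \<Rightarrow> bool"
  where "lexseg_ideal E \<longleftrightarrow> (\<exists>s K. lex_initial s K \<and>
    E = Idl\<^bsub>SS\<^esub> {mono3 a b c |a b c. (a, b, c) \<in> K} <+>\<^bsub>SS\<^esub> mm [^]\<^bsub>ideals_set SS\<^esub> (s + 1))"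

definition EE :: "nat \<Rightarrow> 'k::field poly3 set"
  where "EE d = (THE E. lexseg_ideal E \<and> E \<in> hilb3 d)"

section \<open>The ideal \<open>J\<close>\<close>

definition JJ :: "nat \<Rightarrow> 'k::field poly3 set"
  where "JJ r =
      Idl\<^bsub>SS\<^esub> {mono3 2 0 0 * mono3 a b c |a b c. a + b + c = r - 2}
    <+>\<^bsub>SS\<^esub> Idl\<^bsub>SS\<^esub> {mono3 1 1 0 * mono3 0 b c |b c. b + c = r - 2}
    <+>\<^bsub>SS\<^esub> Idl\<^bsub>SS\<^esub> {mono3 1 0 r}
    <+>\<^bsub>SS\<^esub> Idl\<^bsub>SS\<^esub> {mono3 0 1 0 * mono3 0 b c |b c. b + c = r}
    <+>\<^bsub>SS\<^esub> Idl\<^bsub>SS\<^esub> {mono3 0 0 (r + 2)}"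

end

(* Both ideals are monomial. A tangent vector at a monomial ideal of finite colength is an array of
coefficients c(m, b), for monomials m inside and b outside the ideal, that is compatible with
multiplication by x, y, z. Any prescription of values on (minimal generator, socle monomial) pairs
extends by zero to such an array, and J and E(d) have equally many minimal generators and equally
many socle monomials. For E(d), sliding (m, b) along multiplication by one variable and division by
another shows that all other coefficients are determined by seven further values; for J there are
ten further independent tangent vectors. Hence dim T(J) - dim T(E(d)) is at least 3. *)
theory Submission
  imports Defs
begin

text \<open>J arises from E(d) by one exchange of monomials: the socle monomial xyz^(r-2) of E(d)
  enters the ideal and the generator z^(r+1) leaves it. This preserves the colength, and it changes
  the lists of generators and of socle monomials in two entries each. The relations between
  coefficients preserve b - m, so values are linked along paths. A path carries zero as soon as b
  lacks a variable by which m can still be divided inside the ideal, and in E(d) most paths from a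
  non-socle b end like this. The exchange cuts paths: in J both x and y take z^r and xz^(r-2) into
  the ideal, so these two b can move only by z, after which they are socle monomials; and for five
  generators g neither gz/x nor gz/y lies in J, so (gz, bz) has no other continuation. Five
  generators times two monomials give the number ten. Only one-sided bounds are proved: from above
  for E(d), by functionals that separate tangent vectors, and from below for J, by a dual
  family.\<close>

lemma ring_of_type_algebra_simps [simp]:
  "carrier ring_of_type_algebra = (UNIV :: 'a::comm_ring_1 set)"
  "monoid.mult ring_of_type_algebra = (\<lambda>x y :: 'a. x * y)"
  "one ring_of_type_algebra = (1 :: 'a)"
  "zero ring_of_type_algebra = (0 :: 'a)"
  "add ring_of_type_algebra = (\<lambda>x y :: 'a. x + y)"
  by (simp_all add: ring_of_type_algebra_def)

section \<open>Dimension bounds from families of linear functionals\<close>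

definition lin_functional :: "('k::field, 'v, 'm) module_scheme \<Rightarrow> ('v \<Rightarrow> 'k) \<Rightarrow> bool"
  where "lin_functional V \<phi> \<longleftrightarrow>
    (\<forall>u\<in>carrier V. \<forall>v\<in>carrier V. \<phi> (u \<oplus>\<^bsub>V\<^esub> v) = \<phi> u + \<phi> v) \<and>
    (\<forall>a. \<forall>v\<in>carrier V. \<phi> (a \<odot>\<^bsub>V\<^esub> v) = a * \<phi> v)"

text \<open>Induction on the functionals: inside U the kernel of one of them has codimension at most
  one, so a single vector \<open>w\<close> outside the kernel completes a spanning set. Working with
  subsets U of a fixed V lets the induction pass to kernels without turning them into vector spaces
  of their own.\<close>

lemma spanning_set_of_functionals:
  fixes V :: "('k::field, 'v, 'm) module_scheme" and \<phi> :: "'i \<Rightarrow> 'v \<Rightarrow> 'k"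
  assumes V: "vectorspace kk V"
    and fin: "finite P"
    and lin: "\<And>i. i \<in> P \<Longrightarrow> lin_functional V (\<phi> i)"
    and U: "U \<subseteq> carrier V"
    and closed: "\<And>u v a. \<lbrakk>u \<in> U; v \<in> U\<rbrakk> \<Longrightarrow> u \<oplus>\<^bsub>V\<^esub> a \<odot>\<^bsub>V\<^esub> v \<in> U"
    and inj: "\<And>u. \<lbrakk>u \<in> U; \<And>i. i \<in> P \<Longrightarrow> \<phi> i u = 0\<rbrakk> \<Longrightarrow> u = \<zero>\<^bsub>V\<^esub>"
  shows "\<exists>B. finite B \<and> B \<subseteq> U \<and> card B \<le> card P \<and> U \<subseteq> module.span kk V B"
  using fin lin U closed inj
proof (induction P arbitrary: U)
  interpret V: vectorspace kk V by (rule V)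
  {
    case empty
    have "U \<subseteq> V.span {}"
      using empty.prems(4) V.span_zero by auto
    then show ?case by (intro exI[of _ "{}"]) auto
  next
    case (insert j P)
    define U' where "U' = {u \<in> U. \<phi> j u = 0}"
    have linj: "lin_functional V (\<phi> j)" using insert.prems(1) by auto
    have 1: "\<exists>B. finite B \<and> B \<subseteq> U' \<and> card B \<le> card P \<and> U' \<subseteq> V.span B"
    proof (rule insert.IH)
      show "\<And>i. i \<in> P \<Longrightarrow> lin_functional V (\<phi> i)" using insert.prems(1) by auto
      show "U' \<subseteq> carrier V" using insert.prems(2) U'_def by auto
      show "u \<oplus>\<^bsub>V\<^esub> a \<odot>\<^bsub>V\<^esub> v \<in> U'" if uv: "u \<in> U'" "v \<in> U'" for u v a
      proof -
        have c: "u \<in> carrier V" "v \<in> carrier V" "a \<odot>\<^bsub>V\<^esub> v \<in> carrier V"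
          using uv insert.prems(2) by (auto simp: U'_def)
        have "\<phi> j (u \<oplus>\<^bsub>V\<^esub> a \<odot>\<^bsub>V\<^esub> v) = \<phi> j u + a * \<phi> j v"
          using linj c by (simp add: lin_functional_def)
        then show ?thesis using uv insert.prems(3)[of u v a] by (auto simp: U'_def)
      qed
      show "u = \<zero>\<^bsub>V\<^esub>" if "u \<in> U'" "\<And>i. i \<in> P \<Longrightarrow> \<phi> i u = 0" for u
        using that insert.prems(4)[of u] by (auto simp: U'_def)
    qed
    then obtain B where B: "finite B" "B \<subseteq> U'" "card B \<le> card P" "U' \<subseteq> V.span B" by blast
    have BV: "B \<subseteq> carrier V" using B(2) insert.prems(2) by (auto simp: U'_def)
    show ?case
    proof (cases "U \<subseteq> U'")
      case True
      then show ?thesis using B insert.hyps by (intro exI[of _ B]) (auto simp: U'_def)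
    next
      case False
      then obtain w where w: "w \<in> U" "\<phi> j w \<noteq> 0" by (auto simp: U'_def)
      have wV: "w \<in> carrier V" using w insert.prems(2) by auto
      let ?B = "B \<union> {w}"
      have BwV: "?B \<subseteq> carrier V" using BV wV by auto
      have "u \<in> V.span ?B" if u: "u \<in> U" for u
      proof -
        define a where "a = \<phi> j u / \<phi> j w"
        have uV: "u \<in> carrier V" using u insert.prems(2) by auto
        define u' where "u' = u \<oplus>\<^bsub>V\<^esub> (-a) \<odot>\<^bsub>V\<^esub> w"
        have u'V: "u' \<in> carrier V" using uV wV by (auto simp: u'_def)
        have "\<phi> j u' = 0"
          using linj uV wV w(2) by (simp add: lin_functional_def u'_def a_def)
        then have "u' \<in> V.span B"
          using B(4) insert.prems(3)[OF u w(1)] by (auto simp: U'_def u'_def)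
        then have u's: "u' \<in> V.span ?B" using V.span_is_monotone[of B ?B] by auto
        have sm: "submodule kk (V.span ?B) V" by (rule V.span_is_submodule[OF BwV])
        have "w \<in> V.span ?B" using V.in_own_span[OF BwV] by auto
        then have aw: "a \<odot>\<^bsub>V\<^esub> w \<in> V.span ?B"
          using submodule.smult_closed[OF sm, of a w] by simp
        have "u' \<oplus>\<^bsub>V\<^esub> a \<odot>\<^bsub>V\<^esub> w = u \<oplus>\<^bsub>V\<^esub> ((-a) \<odot>\<^bsub>V\<^esub> w \<oplus>\<^bsub>V\<^esub> a \<odot>\<^bsub>V\<^esub> w)"
          using uV wV by (simp add: u'_def V.M.a_assoc)
        also have "(-a) \<odot>\<^bsub>V\<^esub> w \<oplus>\<^bsub>V\<^esub> a \<odot>\<^bsub>V\<^esub> w = \<zero>\<^bsub>V\<^esub>"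
          using V.smult_l_distr[of "-a" a w] wV V.smult_l_null[of w] by simp
        finally have "u = u' \<oplus>\<^bsub>V\<^esub> a \<odot>\<^bsub>V\<^esub> w" using uV by simp
        moreover have "u' \<oplus>\<^bsub>V\<^esub> a \<odot>\<^bsub>V\<^esub> w \<in> V.span ?B"
          using V.span_add1[OF BwV u's aw] .
        ultimately show ?thesis by simp
      qed
      then show ?thesis
        using B insert.hyps w(1)
        by (intro exI[of _ ?B]) (auto simp: U'_def card_insert_if le_SucI)
    qed
  }
qed

lemma dim_le_card_functionals:
  fixes V :: "('k::field, 'v, 'm) module_scheme" and \<phi> :: "'i \<Rightarrow> 'v \<Rightarrow> 'k"
  assumes V: "vectorspace kk V"
    and fin: "finite P"
    and lin: "\<And>i. i \<in> P \<Longrightarrow> lin_functional V (\<phi> i)"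
    and inj: "\<And>u. \<lbrakk>u \<in> carrier V; \<And>i. i \<in> P \<Longrightarrow> \<phi> i u = 0\<rbrakk> \<Longrightarrow> u = \<zero>\<^bsub>V\<^esub>"
  shows "vectorspace.fin_dim kk V \<and> vectorspace.dim kk V \<le> card P"
proof -
  interpret V: vectorspace kk V by (rule V)
  have "\<exists>B. finite B \<and> B \<subseteq> carrier V \<and> card B \<le> card P \<and> carrier V \<subseteq> V.span B"
    by (rule spanning_set_of_functionals[where \<phi> = \<phi>]) (use V fin lin inj in auto)
  then obtain B where B: "finite B" "B \<subseteq> carrier V" "card B \<le> card P" "carrier V \<subseteq> V.span B"
    by blast
  have gen: "V.span B = carrier V" using B V.span_is_subset2[of B] by auto
  have "V.fin_dim" unfolding V.fin_dim_def using B gen by auto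
  moreover have "V.dim \<le> card B" using V.gen_ge_dim B gen by auto
  ultimately show ?thesis using B by auto
qed

text \<open>Applying \<phi> i to a vanishing linear combination isolates the coefficient of
  \<open>w i\<close>, so the vectors \<open>w i\<close> are distinct and independent.\<close>

lemma card_dual_family_le_dim:
  fixes V :: "('k::field, 'v, 'm) module_scheme" and \<phi> :: "'i \<Rightarrow> 'v \<Rightarrow> 'k"
  assumes V: "vectorspace kk V"
    and fd: "vectorspace.fin_dim kk V"
    and fin: "finite Q"
    and lin: "\<And>i. i \<in> Q \<Longrightarrow> lin_functional V (\<phi> i)"
    and w: "\<And>i. i \<in> Q \<Longrightarrow> w i \<in> carrier V"
    and dual: "\<And>i j. \<lbrakk>i \<in> Q; j \<in> Q\<rbrakk> \<Longrightarrow> \<phi> i (w j) = (if i = j then 1 else 0)"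
  shows "card Q \<le> vectorspace.dim kk V"
proof -
  interpret V: vectorspace kk V by (rule V)
  have inj: "inj_on w Q"
    by (rule inj_onI) (metis dual zero_neq_one)
  have sub: "w ` Q \<subseteq> carrier V" using w by auto
  have lc: "\<phi> i (V.lincomb a A) = (\<Sum>v\<in>A. a v * \<phi> i v)"
    if "finite A" "A \<subseteq> carrier V" "i \<in> Q" for i a A
    using that
  proof (induction A)
    case empty
    have "\<phi> i (0 \<odot>\<^bsub>V\<^esub> \<zero>\<^bsub>V\<^esub>) = 0"
      using lin[OF empty(2)] by (simp only: lin_functional_def V.M.zero_closed mult_zero_left)
    then show ?case by simp
  next
    case (insert v A)
    have "V.lincomb a (A \<union> {v}) = a v \<odot>\<^bsub>V\<^esub> v \<oplus>\<^bsub>V\<^esub> V.lincomb a A"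
      by (rule V.lincomb_insert) (use insert in auto)
    moreover have "V.lincomb a A \<in> carrier V" using insert by auto
    ultimately show ?case using insert lin[OF insert.prems(2)] by (simp add: lin_functional_def)
  qed
  have "V.lin_indpt (w ` Q)"
  proof (rule V.finite_lin_indpt2[OF finite_imageI[OF fin] sub])
    fix a assume 0: "V.lincomb a (w ` Q) = \<zero>\<^bsub>V\<^esub>"
    have z: "V.lincomb a {} = \<zero>\<^bsub>V\<^esub>" by simp
    show "\<forall>v\<in>w ` Q. a v = \<zero>\<^bsub>kk\<^esub>"
    proof clarsimp
      fix i assume i: "i \<in> Q"
      have "0 = \<phi> i (V.lincomb a (w ` Q))"
        unfolding 0 using lc[of "{}" i a] i z by simp
      also have "\<dots> = (\<Sum>v\<in>w ` Q. a v * \<phi> i v)" by (rule lc) (use fin sub i in auto)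
      also have "\<dots> = (\<Sum>j\<in>Q. a (w j) * \<phi> i (w j))" by (simp add: sum.reindex[OF inj])
      also have "\<dots> = (\<Sum>j\<in>Q. if i = j then a (w j) else 0)"
        by (rule sum.cong) (use dual i in auto)
      also have "\<dots> = a (w i)" using fin i by simp
      finally show "a (w i) = 0" by simp
    qed
  qed
  then have "card (w ` Q) \<le> V.dim" using V.li_le_dim[OF fd sub] by auto
  then show ?thesis by (simp add: card_image[OF inj])
qed


section \<open>Cosets and homomorphisms into the quotient\<close>

text \<open>A concrete form of the additive coset I + p, which makes equality of cosets a matter of
  one difference lying in I.\<close>

definition cos3 :: "'k::field poly3 set \<Rightarrow> 'k poly3 \<Rightarrow> 'k poly3 set"
  where "cos3 I p = {q. q - p \<in> I}"

lemma a_r_coset_SS: "I +>\<^bsub>SS\<^esub> p = cos3 I p"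
  unfolding a_r_coset_def' cos3_def by (auto simp: algebra_simps intro: bexI[of _ "_ - p"])

locale ideal3 =
  fixes I :: "'k::field poly3 set"
  assumes ideal: "ideal I SS"
begin

sublocale ideal I SS by (rule ideal)

lemma zero_mem [simp]: "0 \<in> I"
  using additive_subgroup.zero_closed[OF ideal.axioms(1)[OF ideal]] by simp

lemma add_mem: "\<lbrakk>p \<in> I; q \<in> I\<rbrakk> \<Longrightarrow> p + q \<in> I"
  using additive_subgroup.a_closed[OF ideal.axioms(1)[OF ideal]] by simp

lemma mult_mem: "p \<in> I \<Longrightarrow> a * p \<in> I"
  using I_l_closed[of p a] by simp

lemma uminus_mem: "p \<in> I \<Longrightarrow> - p \<in> I"
  using mult_mem[of p "- 1"] by simp

lemma diff_mem: "\<lbrakk>p \<in> I; q \<in> I\<rbrakk> \<Longrightarrow> p - q \<in> I"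
  using add_mem[of p "- q"] uminus_mem[of q] by simp

lemma cos3_self: "p \<in> cos3 I p"
  by (simp add: cos3_def)

lemma cos3_eq: "cos3 I p = cos3 I q \<longleftrightarrow> p - q \<in> I"
proof
  assume "cos3 I p = cos3 I q"
  then show "p - q \<in> I" using cos3_self[of p] by (simp add: cos3_def)
next
  assume pq: "p - q \<in> I"
  have "u - p \<in> I \<longleftrightarrow> u - q \<in> I" for u
    using add_mem[OF _ pq, of "u - p"] diff_mem[OF _ pq, of "u - q"] by auto
  then show "cos3 I p = cos3 I q" by (simp add: cos3_def)
qed

lemma quot_carrier: "carrier (SS Quot I) = range (cos3 I)"
  by (auto simp: FactRing_def A_RCOSETS_def' a_r_coset_SS)

lemma quot_add: "cos3 I p \<oplus>\<^bsub>SS Quot I\<^esub> cos3 I q = cos3 I (p + q)"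
  using a_rcos_sum[of p q] by (simp add: FactRing_def a_r_coset_SS)

lemma quot_mult: "cos3 I p \<otimes>\<^bsub>SS Quot I\<^esub> cos3 I q = cos3 I (p * q)"
  using rcoset_mult_add[of p q] by (simp add: FactRing_def a_r_coset_SS)

lemma quot_zero: "\<zero>\<^bsub>SS Quot I\<^esub> = cos3 I 0"
  by (simp add: FactRing_def cos3_def)

lemma quot_mod_simps [simp]:
  "carrier (quot_mod SS I) = range (cos3 I)"
  "cos3 I p \<oplus>\<^bsub>quot_mod SS I\<^esub> cos3 I q = cos3 I (p + q)"
  "a \<odot>\<^bsub>quot_mod SS I\<^esub> cos3 I q = cos3 I (a * q)"
  "\<zero>\<^bsub>quot_mod SS I\<^esub> = cos3 I 0"
  by (simp_all add: quot_mod_def quot_carrier quot_add quot_mult quot_zero a_r_coset_SS)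

lemma quot_space_simps [simp]:
  "carrier (quot_space I) = range (cos3 I)"
  "cos3 I p \<oplus>\<^bsub>quot_space I\<^esub> cos3 I q = cos3 I (p + q)"
  "a \<odot>\<^bsub>quot_space I\<^esub> cos3 I q = cos3 I (const3 a * q)"
  "\<zero>\<^bsub>quot_space I\<^esub> = cos3 I 0"
  by (simp_all add: quot_space_def restrict_scalars_def)

lemma const3_simps: "const3 (a + b) = const3 a + const3 b" "const3 (a * b) = const3 a * const3 b"
  "const3 1 = 1"
  by (simp_all add: const3_def single_add mult_single)

lemma vectorspace_quot_space: "vectorspace kk (quot_space I)"
proof -
  have "abelian_group (quot_space I)"
  proof (rule abelian_groupI)
    fix x assume "x \<in> carrier (quot_space I)"
    then obtain p where "x = cos3 I p" by auto
    then show "\<exists>y\<in>carrier (quot_space I). y \<oplus>\<^bsub>quot_space I\<^esub> x = \<zero>\<^bsub>quot_space I\<^esub>"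
      by (auto intro!: exI[of _ "- p"])
  qed (auto simp: algebra_simps)
  then have "module kk (quot_space I)"
    by (intro moduleI cring_from_type_algebra) (auto simp: algebra_simps const3_simps)
  then show ?thesis by (simp add: vectorspace_def field_from_type_algebra)
qed

lemma tangent_space_carrier:
  "f \<in> carrier (tangent_space I) \<longleftrightarrow> f \<in> extensional I \<and> (\<forall>p\<in>I. f p \<in> range (cos3 I)) \<and>
    (\<forall>p\<in>I. \<forall>q\<in>I. f (p + q) = f p \<oplus>\<^bsub>quot_mod SS I\<^esub> f q) \<and>
    (\<forall>a. \<forall>p\<in>I. f (a * p) = a \<odot>\<^bsub>quot_mod SS I\<^esub> f p)"
  by (auto simp: tangent_space_def restrict_scalars_def hom_mod_def module_hom_def ideal_mod_def)

lemma tangent_space_simps: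
  "f \<oplus>\<^bsub>tangent_space I\<^esub> g = (\<lambda>p\<in>I. f p \<oplus>\<^bsub>quot_mod SS I\<^esub> g p)"
  "a \<odot>\<^bsub>tangent_space I\<^esub> f = (\<lambda>p\<in>I. const3 a \<odot>\<^bsub>quot_mod SS I\<^esub> f p)"
  "\<zero>\<^bsub>tangent_space I\<^esub> = (\<lambda>p\<in>I. cos3 I 0)"
  by (simp_all add: tangent_space_def restrict_scalars_def hom_mod_def ideal_mod_def)

text \<open>Choosing representatives replaces a map into cosets by a map F into polynomials that is
  additive and S-linear only modulo I. Closure and module laws then become statements about
  membership in I.\<close>

lemma tangent_repr:
  "f \<in> carrier (tangent_space I) \<longleftrightarrow> (\<exists>F. f = (\<lambda>p\<in>I. cos3 I (F p)) \<and>
    (\<forall>p\<in>I. \<forall>q\<in>I. F (p + q) - (F p + F q) \<in> I) \<and> (\<forall>a. \<forall>p\<in>I. F (a * p) - a * F p \<in> I))"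
proof
  assume f: "f \<in> carrier (tangent_space I)"
  then have "\<forall>p\<in>I. \<exists>q. f p = cos3 I q" unfolding tangent_space_carrier by blast
  then obtain F where F: "\<And>p. p \<in> I \<Longrightarrow> f p = cos3 I (F p)" by metis
  have "f = (\<lambda>p\<in>I. cos3 I (F p))"
    using F f by (auto simp: tangent_space_carrier extensional_def fun_eq_iff)
  moreover have "F (p + q) - (F p + F q) \<in> I" if "p \<in> I" "q \<in> I" for p q
    using f that F[of p] F[of q] F[of "p + q"] add_mem[of p q]
    by (simp add: tangent_space_carrier flip: cos3_eq)
  moreover have "F (a * p) - a * F p \<in> I" if "p \<in> I" for p a
    using f that F[of p] F[of "a * p"] mult_mem[of p a]
    by (simp add: tangent_space_carrier flip: cos3_eq)
  ultimately show "\<exists>F. f = (\<lambda>p\<in>I. cos3 I (F p)) \<and>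
    (\<forall>p\<in>I. \<forall>q\<in>I. F (p + q) - (F p + F q) \<in> I) \<and> (\<forall>a. \<forall>p\<in>I. F (a * p) - a * F p \<in> I)"
    by blast
next
  assume "\<exists>F. f = (\<lambda>p\<in>I. cos3 I (F p)) \<and>
    (\<forall>p\<in>I. \<forall>q\<in>I. F (p + q) - (F p + F q) \<in> I) \<and> (\<forall>a. \<forall>p\<in>I. F (a * p) - a * F p \<in> I)"
  then obtain F where F: "f = (\<lambda>p\<in>I. cos3 I (F p))"
    "\<forall>p\<in>I. \<forall>q\<in>I. F (p + q) - (F p + F q) \<in> I" "\<forall>a. \<forall>p\<in>I. F (a * p) - a * F p \<in> I"
    by blast
  show "f \<in> carrier (tangent_space I)"
    unfolding tangent_space_carrier F(1) using F(2,3) add_mem mult_mem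
    by (auto simp: cos3_eq)
qed

lemma vectorspace_tangent_space: "vectorspace kk (tangent_space I)"
proof -
  let ?T = "tangent_space I"
  have add: "f \<oplus>\<^bsub>?T\<^esub> g \<in> carrier ?T" if "f \<in> carrier ?T" "g \<in> carrier ?T" for f g
  proof -
    from that obtain F G where F: "f = (\<lambda>p\<in>I. cos3 I (F p))"
      "\<forall>p\<in>I. \<forall>q\<in>I. F (p + q) - (F p + F q) \<in> I" "\<forall>a. \<forall>p\<in>I. F (a * p) - a * F p \<in> I"
      and G: "g = (\<lambda>p\<in>I. cos3 I (G p))"
      "\<forall>p\<in>I. \<forall>q\<in>I. G (p + q) - (G p + G q) \<in> I" "\<forall>a. \<forall>p\<in>I. G (a * p) - a * G p \<in> I"
      unfolding tangent_repr by blast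
    have "f \<oplus>\<^bsub>?T\<^esub> g = (\<lambda>p\<in>I. cos3 I (F p + G p))"
      by (rule ext) (simp add: tangent_space_simps F(1) G(1))
    moreover have "F (p + q) + G (p + q) - (F p + G p + (F q + G q)) \<in> I" if "p \<in> I" "q \<in> I" for p q
      using add_mem[OF F(2)[rule_format, OF that] G(2)[rule_format, OF that]] by (simp add: algebra_simps)
    moreover have "F (a * p) + G (a * p) - a * (F p + G p) \<in> I" if "p \<in> I" for a p
      using add_mem[OF F(3)[rule_format, OF that] G(3)[rule_format, OF that], of a a]
      by (simp add: algebra_simps)
    ultimately show ?thesis unfolding tangent_repr by (intro exI[of _ "\<lambda>p. F p + G p"]) auto
  qed
  have smult: "a \<odot>\<^bsub>?T\<^esub> f \<in> carrier ?T" if "f \<in> carrier ?T" for a f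
  proof -
    from that obtain F where F: "f = (\<lambda>p\<in>I. cos3 I (F p))"
      "\<forall>p\<in>I. \<forall>q\<in>I. F (p + q) - (F p + F q) \<in> I" "\<forall>a. \<forall>p\<in>I. F (a * p) - a * F p \<in> I"
      unfolding tangent_repr by blast
    have "a \<odot>\<^bsub>?T\<^esub> f = (\<lambda>p\<in>I. cos3 I (const3 a * F p))"
      by (rule ext) (simp add: tangent_space_simps F(1))
    moreover have "const3 a * F (p + q) - (const3 a * F p + const3 a * F q) \<in> I"
      if "p \<in> I" "q \<in> I" for p q
      using mult_mem[OF F(2)[rule_format, OF that], of "const3 a"] by (simp add: algebra_simps)
    moreover have "const3 a * F (b * p) - b * (const3 a * F p) \<in> I" if "p \<in> I" for b p
      using mult_mem[OF F(3)[rule_format, OF that], of "const3 a" b] by (simp add: algebra_simps)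
    ultimately show ?thesis unfolding tangent_repr by (intro exI[of _ "\<lambda>p. const3 a * F p"]) auto
  qed
  have zero: "\<zero>\<^bsub>?T\<^esub> \<in> carrier ?T"
    unfolding tangent_repr tangent_space_simps by (intro exI[of _ "\<lambda>p. 0"]) auto
  have repr: "\<exists>F. f = (\<lambda>p\<in>I. cos3 I (F p))" if "f \<in> carrier ?T" for f
    using that unfolding tangent_repr by blast
  have "abelian_group ?T"
  proof (rule abelian_groupI)
    show "x \<oplus>\<^bsub>?T\<^esub> y \<in> carrier ?T" if "x \<in> carrier ?T" "y \<in> carrier ?T" for x y
      using that by (rule add)
    show "\<zero>\<^bsub>?T\<^esub> \<in> carrier ?T" by (rule zero)
    show "x \<oplus>\<^bsub>?T\<^esub> y \<oplus>\<^bsub>?T\<^esub> z = x \<oplus>\<^bsub>?T\<^esub> (y \<oplus>\<^bsub>?T\<^esub> z)"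
      if xyz: "x \<in> carrier ?T" "y \<in> carrier ?T" "z \<in> carrier ?T" for x y z
      using repr[OF xyz(1)] repr[OF xyz(2)] repr[OF xyz(3)]
      by (auto simp: tangent_space_simps fun_eq_iff add.assoc)
    show "x \<oplus>\<^bsub>?T\<^esub> y = y \<oplus>\<^bsub>?T\<^esub> x" if xy: "x \<in> carrier ?T" "y \<in> carrier ?T" for x y
      using repr[OF xy(1)] repr[OF xy(2)]
      by (auto simp: tangent_space_simps fun_eq_iff add.commute)
    show "\<zero>\<^bsub>?T\<^esub> \<oplus>\<^bsub>?T\<^esub> x = x" if x: "x \<in> carrier ?T" for x
      using repr[OF x] by (auto simp: tangent_space_simps fun_eq_iff)
    show "\<exists>y\<in>carrier ?T. y \<oplus>\<^bsub>?T\<^esub> x = \<zero>\<^bsub>?T\<^esub>" if x: "x \<in> carrier ?T" for x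
    proof
      show "(- 1) \<odot>\<^bsub>?T\<^esub> x \<oplus>\<^bsub>?T\<^esub> x = \<zero>\<^bsub>?T\<^esub>"
        using repr[OF x]
        by (auto simp: tangent_space_simps fun_eq_iff const3_def single_uminus)
    qed (rule smult[OF x])
  qed
  then have "module kk ?T"
  proof (intro moduleI cring_from_type_algebra)
    show "a \<odot>\<^bsub>?T\<^esub> x \<in> carrier ?T" if "x \<in> carrier ?T" for a x using that by (rule smult)
    show "(a \<oplus>\<^bsub>kk\<^esub> b) \<odot>\<^bsub>?T\<^esub> x = a \<odot>\<^bsub>?T\<^esub> x \<oplus>\<^bsub>?T\<^esub> b \<odot>\<^bsub>?T\<^esub> x"
      if x: "x \<in> carrier ?T" for a b x
      using repr[OF x] by (auto simp: tangent_space_simps fun_eq_iff const3_simps algebra_simps)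
    show "a \<odot>\<^bsub>?T\<^esub> (x \<oplus>\<^bsub>?T\<^esub> y) = a \<odot>\<^bsub>?T\<^esub> x \<oplus>\<^bsub>?T\<^esub> a \<odot>\<^bsub>?T\<^esub> y"
      if xy: "x \<in> carrier ?T" "y \<in> carrier ?T" for a x y
      using repr[OF xy(1)] repr[OF xy(2)]
      by (auto simp: tangent_space_simps fun_eq_iff algebra_simps)
    show "(a \<otimes>\<^bsub>kk\<^esub> b) \<odot>\<^bsub>?T\<^esub> x = a \<odot>\<^bsub>?T\<^esub> (b \<odot>\<^bsub>?T\<^esub> x)"
      if x: "x \<in> carrier ?T" for a b x
      using repr[OF x] by (auto simp: tangent_space_simps fun_eq_iff const3_simps algebra_simps)
    show "\<one>\<^bsub>kk\<^esub> \<odot>\<^bsub>?T\<^esub> x = x" if x: "x \<in> carrier ?T" for x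
      using repr[OF x] by (auto simp: tangent_space_simps fun_eq_iff const3_simps)
  qed
  then show ?thesis by (simp add: vectorspace_def field_from_type_algebra)
qed

end


section \<open>Tangent vectors of monomial ideals as coefficient functions\<close>

text \<open>Here \<open>c m b\<close> is the coefficient of the monomial \<open>b\<close> in the image of the monomial \<open>m\<close>,
  so only its values on \<open>A \<times> - A\<close> matter. The conditions say that multiplication by a variable
  commutes with the map; a negative exponent on the right would mean a zero coefficient.\<close>

definition tangent_fun ::
    "(nat \<times> nat \<times> nat) set \<Rightarrow> (nat \<times> nat \<times> nat \<Rightarrow> nat \<times> nat \<times> nat \<Rightarrow> 'k::zero) \<Rightarrow> bool"
  where "tangent_fun A c \<longleftrightarrow> (\<forall>m1 m2 m3. (m1, m2, m3) \<in> A \<longrightarrow>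
    (\<forall>b1 b2 b3. (Suc b1, b2, b3) \<notin> A \<longrightarrow>
      c (Suc m1, m2, m3) (Suc b1, b2, b3) = c (m1, m2, m3) (b1, b2, b3)) \<and>
    (\<forall>b1 b2 b3. (b1, Suc b2, b3) \<notin> A \<longrightarrow>
      c (m1, Suc m2, m3) (b1, Suc b2, b3) = c (m1, m2, m3) (b1, b2, b3)) \<and>
    (\<forall>b1 b2 b3. (b1, b2, Suc b3) \<notin> A \<longrightarrow>
      c (m1, m2, Suc m3) (b1, b2, Suc b3) = c (m1, m2, m3) (b1, b2, b3)) \<and>
    (\<forall>b2 b3. (0, b2, b3) \<notin> A \<longrightarrow> c (Suc m1, m2, m3) (0, b2, b3) = 0) \<and>
    (\<forall>b1 b3. (b1, 0, b3) \<notin> A \<longrightarrow> c (m1, Suc m2, m3) (b1, 0, b3) = 0) \<and>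
    (\<forall>b1 b2. (b1, b2, 0) \<notin> A \<longrightarrow> c (m1, m2, Suc m3) (b1, b2, 0) = 0))"

text \<open>Quotients by a variable are expressed by \<open>Suc\<close> equations, so that an
  exponent 0 imposes no condition and truncated subtraction never occurs.\<close>

definition min_gens :: "(nat \<times> nat \<times> nat) set \<Rightarrow> (nat \<times> nat \<times> nat) set"
  where "min_gens A = {(a, b, c). (a, b, c) \<in> A \<and> (\<forall>a'. a = Suc a' \<longrightarrow> (a', b, c) \<notin> A) \<and>
    (\<forall>b'. b = Suc b' \<longrightarrow> (a, b', c) \<notin> A) \<and> (\<forall>c'. c = Suc c' \<longrightarrow> (a, b, c') \<notin> A)}"

definition socle :: "(nat \<times> nat \<times> nat) set \<Rightarrow> (nat \<times> nat \<times> nat) set"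
  where "socle A = {(a, b, c). (a, b, c) \<notin> A \<and>
    (Suc a, b, c) \<in> A \<and> (a, Suc b, c) \<in> A \<and> (a, b, Suc c) \<in> A}"

text \<open>The exponents of the monomials in \<open>E(d)\<close>.\<close>

definition expE :: "nat \<Rightarrow> (nat \<times> nat \<times> nat) set"
  where "expE r = {(a, b, c). r < a + b + c \<or> a + b + c = r \<and> (2 \<le> a \<or> a = 1 \<and> 2 \<le> b)}"

locale tangent_functions =
  fixes A :: "(nat \<times> nat \<times> nat) set" and c :: "nat \<times> nat \<times> nat \<Rightarrow> nat \<times> nat \<times> nat \<Rightarrow> 'k::zero"
  assumes tf: "tangent_fun A c"
begin

lemma
  assumes "(m1, m2, m3) \<in> A"
  shows shift_x: "(Suc b1, b2, b3) \<notin> A \<Longrightarrow> c (Suc m1, m2, m3) (Suc b1, b2, b3) = c (m1, m2, m3) (b1, b2, b3)"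
    and shift_y: "(b1, Suc b2, b3) \<notin> A \<Longrightarrow> c (m1, Suc m2, m3) (b1, Suc b2, b3) = c (m1, m2, m3) (b1, b2, b3)"
    and shift_z: "(b1, b2, Suc b3) \<notin> A \<Longrightarrow> c (m1, m2, Suc m3) (b1, b2, Suc b3) = c (m1, m2, m3) (b1, b2, b3)"
    and dead_x: "(0, b2, b3) \<notin> A \<Longrightarrow> c (Suc m1, m2, m3) (0, b2, b3) = 0"
    and dead_y: "(b1, 0, b3) \<notin> A \<Longrightarrow> c (m1, Suc m2, m3) (b1, 0, b3) = 0"
    and dead_z: "(b1, b2, 0) \<notin> A \<Longrightarrow> c (m1, m2, Suc m3) (b1, b2, 0) = 0"
  using tf assms unfolding tangent_fun_def by blast+

text \<open>Multiplying by one variable and then dividing by another; the intermediate exponent of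
  \<open>m\<close> lies in \<open>A\<close> automatically, that of \<open>b\<close> must stay outside.\<close>

lemma slide_zx: "\<lbrakk>(m1, m2, Suc m3) \<in> A; (Suc m1, m2, m3) \<in> A; (Suc b1, b2, Suc b3) \<notin> A\<rbrakk>
    \<Longrightarrow> c (m1, m2, Suc m3) (b1, b2, Suc b3) = c (Suc m1, m2, m3) (Suc b1, b2, b3)"
  using shift_x[of m1 m2 "Suc m3" b1 b2 "Suc b3"] shift_z[of "Suc m1" m2 m3 "Suc b1" b2 b3] by simp

lemma slide_yx: "\<lbrakk>(m1, Suc m2, m3) \<in> A; (Suc m1, m2, m3) \<in> A; (Suc b1, Suc b2, b3) \<notin> A\<rbrakk>
    \<Longrightarrow> c (m1, Suc m2, m3) (b1, Suc b2, b3) = c (Suc m1, m2, m3) (Suc b1, b2, b3)"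
  using shift_x[of m1 "Suc m2" m3 b1 "Suc b2" b3] shift_y[of "Suc m1" m2 m3 "Suc b1" b2 b3] by simp

lemma slide_zy: "\<lbrakk>(m1, m2, Suc m3) \<in> A; (m1, Suc m2, m3) \<in> A; (b1, Suc b2, Suc b3) \<notin> A\<rbrakk>
    \<Longrightarrow> c (m1, m2, Suc m3) (b1, b2, Suc b3) = c (m1, Suc m2, m3) (b1, Suc b2, b3)"
  using shift_y[of m1 m2 "Suc m3" b1 b2 "Suc b3"] shift_z[of m1 "Suc m2" m3 b1 "Suc b2" b3] by simp

text \<open>The path of \<open>slide_zx\<close>, except that b has no factor z to give up: after
  multiplication by x, the division by z leads to a negative exponent and the coefficient is zero.
  The other \<open>dead_\<close> lemmas with two variables follow the same pattern.\<close>

lemma dead_zx: "\<lbrakk>(m1, m2, Suc m3) \<in> A; (Suc m1, m2, m3) \<in> A; (Suc b1, b2, 0) \<notin> A\<rbrakk>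
    \<Longrightarrow> c (m1, m2, Suc m3) (b1, b2, 0) = 0"
  using shift_x[of m1 m2 "Suc m3" b1 b2 0] dead_z[of "Suc m1" m2 m3 "Suc b1" b2] by simp

lemma dead_zy: "\<lbrakk>(m1, m2, Suc m3) \<in> A; (m1, Suc m2, m3) \<in> A; (b1, Suc b2, 0) \<notin> A\<rbrakk>
    \<Longrightarrow> c (m1, m2, Suc m3) (b1, b2, 0) = 0"
  using shift_y[of m1 m2 "Suc m3" b1 b2 0] dead_z[of m1 "Suc m2" m3 b1 "Suc b2"] by simp

lemma dead_yx: "\<lbrakk>(m1, Suc m2, m3) \<in> A; (Suc m1, m2, m3) \<in> A; (Suc b1, 0, b3) \<notin> A\<rbrakk>
    \<Longrightarrow> c (m1, Suc m2, m3) (b1, 0, b3) = 0"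
  using shift_x[of m1 "Suc m2" m3 b1 0 b3] dead_y[of "Suc m1" m2 m3 "Suc b1" b3] by simp

lemma dead_yz: "\<lbrakk>(m1, Suc m2, m3) \<in> A; (m1, m2, Suc m3) \<in> A; (b1, 0, Suc b3) \<notin> A\<rbrakk>
    \<Longrightarrow> c (m1, Suc m2, m3) (b1, 0, b3) = 0"
  using shift_z[of m1 "Suc m2" m3 b1 0 b3] dead_y[of m1 m2 "Suc m3" b1 "Suc b3"] by simp

lemma dead_xy: "\<lbrakk>(Suc m1, m2, m3) \<in> A; (m1, Suc m2, m3) \<in> A; (0, Suc b2, b3) \<notin> A\<rbrakk>
    \<Longrightarrow> c (Suc m1, m2, m3) (0, b2, b3) = 0"
  using shift_y[of "Suc m1" m2 m3 0 b2 b3] dead_x[of m1 "Suc m2" m3 "Suc b2" b3] by simp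

end

section \<open>The upper bound for the lexsegment ideal\<close>

text \<open>We write \<open>r = t + 3\<close> to avoid truncated subtraction. The seven values in \<open>params\<close> are the
  only ones that the relations do not tie to values on generators and socle.\<close>

locale tangent_functions_E =
  fixes t :: nat and c :: "nat \<times> nat \<times> nat \<Rightarrow> nat \<times> nat \<times> nat \<Rightarrow> 'k::zero"
  assumes tfE: "tangent_fun (expE (t + 3)) c"
    and gens_socle: "\<And>g b. \<lbrakk>g \<in> min_gens (expE (t + 3)); b \<in> socle (expE (t + 3))\<rbrakk> \<Longrightarrow> c g b = 0"
    and params: "c (1, 2, t) (0, 2, t) = 0" "c (1, 2, t) (1, 0, t + 1) = 0" "c (1, 2, t) (1, 1, t) = 0"
      "c (2, 0, t + 1) (1, 0, t + 1) = 0" "c (2, 0, t + 1) (1, 1, t) = 0"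
      "c (0, 0, t + 4) (1, 0, t + 1) = 0" "c (0, 0, t + 4) (1, 1, t) = 0"
begin

sublocale tangent_functions "expE (t + 3)" c
  by unfold_locales (rule tfE)

abbreviation "AE \<equiv> expE (t + 3)"

lemma AE_iff [simp]: "(a, b, e) \<in> AE \<longleftrightarrow> t + 3 < a + b + e \<or> a + b + e = t + 3 \<and> (2 \<le> a \<or> a = 1 \<and> 2 \<le> b)"
  by (simp add: expE_def)

section \<open>Target monomials of degree at most r - 2\<close>

lemma low_degree_x:
  assumes "(m1, m2, 0) \<in> AE" "b1 + 2 \<le> m1" "b1 + b2 + b3 \<le> t + 1"
  shows "c (m1, m2, 0) (b1, b2, b3) = 0"
  using assms
proof (induction b1 arbitrary: m1 m2 b2)
  case 0
  then obtain k where k: "m1 = Suc (Suc k)" by (metis add_2_eq_Suc le_Suc_ex add_0)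
  \<comment> \<open>The gap \<open>b1 + 2 \<le> m1\<close> survives each trade of x for y. Once b
    has no x left, m still contains x^2, so m y / x keeps a factor x and stays in E(d).\<close>
  show ?case unfolding k by (rule dead_xy) (use 0 k in auto)
next
  case (Suc b1)
  then obtain k where k: "m1 = Suc k" by (cases m1) auto
  have "c (k, Suc m2, 0) (b1, Suc b2, b3) = c (Suc k, m2, 0) (Suc b1, b2, b3)"
    by (rule slide_yx) (use Suc.prems k in auto)
  moreover have "c (k, Suc m2, 0) (b1, Suc b2, b3) = 0"
    by (rule Suc.IH) (use Suc.prems k in auto)
  ultimately show ?case using k by simp
qed

text \<open>Trading y for x keeps m in the lexsegment ideal, and x b has degree at most r - 1, hence
  stays outside. Either b runs out of y, which gives zero, or m becomes a power of x; its exponent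
  is at least r while \<open>b1\<close> is at most r - 2, which is the gap that
  \<open>low_degree_x\<close> requires.\<close>

lemma low_degree_xy:
  assumes "(m1, m2, 0) \<in> AE" "b1 + b2 + b3 \<le> t + 1"
  shows "c (m1, m2, 0) (b1, b2, b3) = 0"
  using assms
proof (induction m2 arbitrary: m1 b1 b2)
  case 0
  show ?case by (rule low_degree_x) (use 0 in auto)
next
  case (Suc m2)
  show ?case
  proof (cases b2)
    case 0
    then show ?thesis using Suc.prems by (simp only:, intro dead_yx) auto
  next
    case (Suc b2')
    have "c (m1, Suc m2, 0) (b1, Suc b2', b3) = c (Suc m1, m2, 0) (Suc b1, b2', b3)"
      by (rule slide_yx) (use Suc Suc.prems in auto)
    also have "\<dots> = 0"
      by (rule Suc.IH) (use Suc Suc.prems in auto)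
    finally show ?thesis using Suc by simp
  qed
qed

text \<open>The same trade with z in place of y removes z from m.\<close>

lemma low_degree:
  assumes "(m1, m2, m3) \<in> AE" "b1 + b2 + b3 \<le> t + 1"
  shows "c (m1, m2, m3) (b1, b2, b3) = 0"
  using assms
proof (induction m3 arbitrary: m1 b1 b3)
  case 0
  then show ?case by (intro low_degree_xy) auto
next
  case (Suc m3)
  show ?case
  proof (cases b3)
    case 0
    then show ?thesis using Suc.prems by (simp only:, intro dead_zx) auto
  next
    case (Suc b3')
    have "c (m1, m2, Suc m3) (b1, b2, Suc b3') = c (Suc m1, m2, m3) (Suc b1, b2, b3')"
      by (rule slide_zx) (use Suc Suc.prems in auto)
    also have "\<dots> = 0"
      by (rule Suc.IH) (use Suc Suc.prems in auto)
    finally show ?thesis using Suc by simp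
  qed
qed

section \<open>Generators of degree r, target monomials of degree r - 1\<close>

lemma x_gen_yz_y_large:
  assumes "m2 + m3 = t + 2" "2 \<le> m2" "b2 + b3 = t + 2" "m2 < b2"
  shows "c (1, m2, m3) (0, b2, b3) = 0"
  using assms
proof (induction b3 arbitrary: b2 m2 m3)
  case 0
  then obtain k where k: "m3 = Suc k" by (cases m3) auto
  \<comment> \<open>Since m and b have equal total exponents in y and z, \<open>m2 < b2\<close>
    means that m contains more z than b. When b has no z left, m still has one.\<close>
  show ?case unfolding k by (rule dead_zy) (use 0 k in auto)
next
  case (Suc b3)
  then obtain k where k: "m3 = Suc k" by (cases m3) auto
  have "c (1, m2, Suc k) (0, b2, Suc b3) = c (1, Suc m2, k) (0, Suc b2, b3)"
    by (rule slide_zy) (use Suc.prems k in auto)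
  also have "\<dots> = 0" by (rule Suc.IH) (use Suc.prems k in auto)
  finally show ?case using k by simp
qed

text \<open>Trading y for z moves m down to x y^2 z^t, the lexicographically last monomial of degree
  r in E(d). There every target is killed by some path except y^2 z^t, whose value is the first
  entry of \<open>params\<close>.\<close>

lemma x_gen_yz:
  assumes "m2 + m3 = t + 2" "2 \<le> m2" "b2 + b3 = t + 2"
  shows "c (1, m2, m3) (0, b2, b3) = 0"
  using assms
proof (induction m2 arbitrary: b2 m3 b3)
  case 0
  then show ?case by simp
next
  case (Suc k)
  show ?case
  proof (cases "k = 1")
    case True
    then have m: "Suc k = 2" "m3 = t" using Suc.prems by auto
    consider "b2 = 0" | "b2 = 1" | "b2 = 2" | "2 < b2" by linarith
    then show ?thesis
    proof cases
      case 1
      have "c (1, Suc 1, t) (0, 0, b3) = 0"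
        by (rule dead_yx) (use Suc.prems 1 in auto)
      then show ?thesis using m 1 by (simp add: numeral_2_eq_2)
    next
      case 2
      \<comment> \<open>The detour leads through x^2 y z^t with target x z^(t+1); this target has no
        y, and a trade of y for z kills the value.\<close>
      have "c (1, Suc 1, t) (0, Suc 0, b3) = c (Suc 1, 1, t) (Suc 0, 0, b3)"
        by (rule slide_yx) (use Suc.prems 2 in auto)
      also have "\<dots> = c (2, Suc 0, t) (1, 0, b3)" by (simp add: numeral_2_eq_2)
      also have "\<dots> = 0" by (rule dead_yz) (use Suc.prems 2 in auto)
      finally show ?thesis using m 2 by (simp add: numeral_2_eq_2)
    next
      case 3
      then have "b3 = t" using Suc.prems by simp
      then show ?thesis using 3 params(1) by (simp only: m)
    next
      case 4
      then show ?thesis using Suc.prems m by (intro x_gen_yz_y_large) auto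
    qed
  next
    case False
    show ?thesis
    proof (cases b2)
      case 0
      then show ?thesis using Suc.prems False by (simp only:, intro dead_yz) auto
    next
      case (Suc l)
      have "c (1, k, Suc m3) (0, l, Suc b3) = c (1, Suc k, m3) (0, Suc l, b3)"
        by (rule slide_zy) (use Suc Suc.prems False in auto)
      moreover have "c (1, k, Suc m3) (0, l, Suc b3) = 0"
        by (rule Suc.IH) (use Suc Suc.prems False in auto)
      ultimately show ?thesis using Suc by simp
    qed
  qed
qed

text \<open>The target has no x, so trading x for y kills the value whenever m y / x stays in the
  ideal. This fails for x^2 z^(t+1), where z is first traded for y, and for m containing x only
  once, which is \<open>x_gen_yz\<close>.\<close>

lemma degree_r_yz:
  assumes "m1 + m2 + m3 = t + 3" "(m1, m2, m3) \<in> AE" "b2 + b3 = t + 2"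
  shows "c (m1, m2, m3) (0, b2, b3) = 0"
proof -
  have pos: "c (m1, m2, m3) (0, b2, b3) = 0"
    if "m1 + m2 + m3 = t + 3" "3 \<le> m1 \<or> m1 = 2 \<and> 1 \<le> m2" "b2 + b3 = t + 2" for m1 m2 m3 b2 b3
  proof -
    from that obtain k where k: "m1 = Suc k" by (cases m1) auto
    show ?thesis unfolding k by (rule dead_xy) (use that k in auto)
  qed
  consider "3 \<le> m1 \<or> m1 = 2 \<and> 1 \<le> m2" | "m1 = 2" "m2 = 0" | "m1 = 1" "2 \<le> m2"
    using assms by fastforce
  then show ?thesis
  proof cases
    case 1
    then show ?thesis using assms pos by blast
  next
    case 2
    then have m3: "m3 = Suc t" using assms by simp
    show ?thesis
    proof (cases b3)
      case 0
      then show ?thesis using assms 2 m3 by (simp only:, intro dead_zy) auto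
    next
      case (Suc l)
      have "c (2, 0, Suc t) (0, b2, Suc l) = c (2, Suc 0, t) (0, Suc b2, l)"
        by (rule slide_zy) (use assms 2 Suc in auto)
      also have "\<dots> = 0" by (rule pos) (use assms Suc in auto)
      finally show ?thesis using 2 m3 Suc by simp
    qed
  next
    case 3
    then show ?thesis using assms by (simp only:, intro x_gen_yz) auto
  qed
qed

lemma degree_r_xz:
  assumes "m1 + m2 + m3 = t + 3" "(m1, m2, m3) \<in> AE"
  shows "c (m1, m2, m3) (1, 0, t + 1) = 0"
proof -
  consider "3 \<le> m1 \<or> m1 = 2 \<and> 1 \<le> m2" | "m1 = 2" "m2 = 0" | "m1 = 1" "3 \<le> m2" | "m1 = 1" "m2 = 2"
    using assms by fastforce
  then show ?thesis
  proof cases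
    case 1
    then obtain k where k: "m1 = Suc k" by (cases m1) auto
    have "c (k, Suc m2, m3) (0, Suc 0, t + 1) = c (Suc k, m2, m3) (Suc 0, 0, t + 1)"
      by (rule slide_yx) (use assms 1 k in auto)
    moreover have "c (k, Suc m2, m3) (0, Suc 0, t + 1) = 0"
      by (rule degree_r_yz) (use assms 1 k in auto)
    ultimately show ?thesis using k by simp
  next
    case 2
    then show ?thesis using assms params by simp
  next
    case 3
    then obtain k where k: "m2 = Suc k" by (cases m2) auto
    show ?thesis unfolding k by (rule dead_yz) (use assms 3 k in auto)
  next
    case 4
    then show ?thesis using assms params by simp
  qed
qed

text \<open>Multiplication by x or by y takes the target xyz^t into the ideal, so every path has to
  pass through its multiple xyz^(t+1). From there one continues to yz^(t+1) or xz^(t+1), both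
  already settled.\<close>

lemma degree_r_xyz:
  assumes "m1 + m2 + m3 = t + 3" "(m1, m2, m3) \<in> AE"
  shows "c (m1, m2, m3) (1, 1, t) = 0"
proof -
  consider "3 \<le> m1 \<or> m1 = 2 \<and> 2 \<le> m2" | "m1 = 2" "m2 = 0" | "m1 = 2" "m2 = 1"
    | "m1 = 1" "3 \<le> m2" | "m1 = 1" "m2 = 2"
    using assms by fastforce
  then show ?thesis
  proof cases
    case 1
    then obtain k where k: "m1 = Suc k" by (cases m1) auto
    have "c (Suc k, m2, m3) (1, 1, t) = c (Suc k, m2, Suc m3) (1, 1, Suc t)"
      by (rule shift_z[symmetric]) (use assms k in auto)
    also have "\<dots> = c (k, m2, Suc m3) (0, 1, Suc t)"
      using shift_x[of k m2 "Suc m3" 0 1 "Suc t"] assms 1 k by auto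
    also have "\<dots> = 0" by (rule degree_r_yz) (use assms 1 k in auto)
    finally show ?thesis using k by simp
  next
    case 2
    then show ?thesis using assms params by simp
  next
    case 3
    have "c (2, 0, Suc t) (1, 0, Suc t) = c (2, Suc 0, t) (1, Suc 0, t)"
      by (rule slide_zy) auto
    then show ?thesis using params 3 assms by simp
  next
    case 4
    then obtain k where k: "m2 = Suc k" by (cases m2) auto
    have "c (1, k, Suc m3) (1, 0, Suc t) = c (1, Suc k, m3) (1, Suc 0, t)"
      by (rule slide_zy) (use assms 4 k in auto)
    moreover have "c (1, k, Suc m3) (1, 0, Suc t) = 0"
      using degree_r_xz[of 1 k "Suc m3"] assms 4 k by simp
    ultimately show ?thesis using 4 k by simp
  next
    case 5
    then show ?thesis using assms params by simp
  qed
qed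

section \<open>Generators of degree r + 1, target monomials of degree r - 1\<close>

lemma gen_yz_y_large:
  assumes "b2 < m2" "m2 + m3 = t + 4" "b2 + b3 = t + 2"
  shows "c (0, m2, m3) (0, b2, b3) = 0"
  using assms
proof (induction b2 arbitrary: m2 m3 b3)
  case 0
  then obtain k where k: "m2 = Suc k" by (cases m2) auto
  show ?case unfolding k by (rule dead_yz) (use 0 k in auto)
next
  case (Suc b2)
  then obtain k where k: "m2 = Suc k" by (cases m2) auto
  have "c (0, k, Suc m3) (0, b2, Suc b3) = c (0, Suc k, m3) (0, Suc b2, b3)"
    by (rule slide_zy) (use Suc.prems k in auto)
  moreover have "c (0, k, Suc m3) (0, b2, Suc b3) = 0" by (rule Suc.IH) (use Suc.prems k in auto)
  ultimately show ?case using k by simp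
qed

lemma gen_yz_z_large:
  assumes "b3 < m3" "m2 + m3 = t + 4" "b2 + b3 = t + 2"
  shows "c (0, m2, m3) (0, b2, b3) = 0"
  using assms
proof (induction b3 arbitrary: m2 m3 b2)
  case 0
  then obtain k where k: "m3 = Suc k" by (cases m3) auto
  show ?case unfolding k by (rule dead_zy) (use 0 k in auto)
next
  case (Suc b3)
  then obtain k where k: "m3 = Suc k" by (cases m3) auto
  have "c (0, m2, Suc k) (0, b2, Suc b3) = c (0, Suc m2, k) (0, Suc b2, b3)"
    by (rule slide_zy) (use Suc.prems k in auto)
  also have "\<dots> = 0" by (rule Suc.IH) (use Suc.prems k in auto)
  finally show ?case using k by simp
qed

text \<open>The degree of m exceeds that of b by two, so m has the larger exponent in y or in z.
  That variable is traded for the other one until b has none of it left.\<close>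

lemma gen_yz:
  assumes "m2 + m3 = t + 4" "b2 + b3 = t + 2"
  shows "c (0, m2, m3) (0, b2, b3) = 0"
  using gen_yz_y_large[of b2 m2 m3 b3] gen_yz_z_large[of b3 m3 m2 b2] assms by linarith

text \<open>Trading z for y turns the generator xyz^(t+2) into xy^2z^(t+1), which is no longer
  minimal. Dividing by z then lowers the target to degree r - 2, where \<open>low_degree\<close>
  applies.\<close>

lemma gen_xy_yz:
  assumes "b2 + b3 = t + 2"
  shows "c (1, 1, t + 2) (0, b2, b3) = 0"
proof (cases b3)
  case 0
  have "c (1, 1, Suc (t + 1)) (0, b2, 0) = 0" by (rule dead_zy) (use assms 0 in auto)
  then show ?thesis using 0 by simp
next
  case (Suc l)
  have "c (1, 1, Suc (t + 1)) (0, b2, Suc l) = c (1, Suc 1, t + 1) (0, Suc b2, l)"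
    by (rule slide_zy) (use assms Suc in auto)
  also have "\<dots> = 0"
  proof (cases l)
    case 0
    show ?thesis using dead_z[of 1 "Suc 1" t 0 "Suc b2"] assms Suc 0 by simp
  next
    case (Suc l')
    have "c (1, Suc 1, Suc t) (0, Suc b2, Suc l') = c (1, Suc 1, t) (0, Suc b2, l')"
      by (rule shift_z) (use assms Suc \<open>b3 = Suc l\<close> in auto)
    also have "\<dots> = 0" by (rule low_degree) (use assms Suc \<open>b3 = Suc l\<close> in auto)
    finally show ?thesis using Suc by simp
  qed
  finally show ?thesis using Suc by simp
qed

lemma gen_xz_yz:
  assumes "b2 + b3 = t + 2"
  shows "c (1, 0, t + 3) (0, b2, b3) = 0"
proof (cases b3)
  case 0
  have "c (1, 0, Suc (t + 2)) (0, b2, 0) = 0" by (rule dead_zy) (use assms 0 in auto)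
  then show ?thesis using 0 by (simp add: eval_nat_numeral)
next
  case (Suc l)
  have "c (1, 0, Suc (t + 2)) (0, b2, Suc l) = c (1, Suc 0, t + 2) (0, Suc b2, l)"
    by (rule slide_zy) (use assms Suc in auto)
  also have "\<dots> = 0" using gen_xy_yz[of "Suc b2" l] assms Suc by simp
  finally show ?thesis using Suc by (simp add: eval_nat_numeral)
qed

text \<open>The first hypothesis lists the minimal generators of degree \<open>r + 1\<close>.\<close>

lemma top_gens:
  assumes "m1 = 0 \<and> m2 + m3 = t + 4 \<or> m1 = 1 \<and> m2 = 1 \<and> m3 = t + 2 \<or> m1 = 1 \<and> m2 = 0 \<and> m3 = t + 3"
  shows "b2 + b3 = t + 2 \<Longrightarrow> c (m1, m2, m3) (0, b2, b3) = 0"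
    and "c (m1, m2, m3) (1, 0, t + 1) = 0"
    and "c (m1, m2, m3) (1, 1, t) = 0"
proof -
  show "c (m1, m2, m3) (0, b2, b3) = 0" if "b2 + b3 = t + 2"
    using assms that gen_yz gen_xy_yz gen_xz_yz by auto
  have y: "c (m1, Suc k, m3) (1, 0, t + 1) = 0"
    if "m1 + Suc k + m3 = t + 4" for m1 k m3
    by (rule dead_yz) (use that in auto)
  show xz: "c (m1, m2, m3) (1, 0, t + 1) = 0"
  proof (cases m2)
    case 0
    then consider "m1 = 0" "m3 = t + 4" | "m1 = 1" "m3 = t + 3" using assms by auto
    then show ?thesis
    proof cases
      case 1
      then show ?thesis using params 0 by simp
    next
      case 2
      have "c (0, Suc 0, t + 3) (0, Suc 0, t + 1) = c (Suc 0, 0, t + 3) (Suc 0, 0, t + 1)"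
        by (rule slide_yx) auto
      moreover have "c (0, Suc 0, t + 3) (0, Suc 0, t + 1) = 0" by (rule gen_yz) auto
      ultimately show ?thesis using 0 2 by simp
    qed
  next
    case (Suc k)
    then show ?thesis using y[of m1 k m3] assms by auto
  qed
  have xz10: "c (1, 0, t + 3) (1, 0, t + 1) = 0"
  proof -
    have "c (0, Suc 0, t + 3) (0, Suc 0, t + 1) = c (Suc 0, 0, t + 3) (Suc 0, 0, t + 1)"
      by (rule slide_yx) auto
    moreover have "c (0, Suc 0, t + 3) (0, Suc 0, t + 1) = 0" by (rule gen_yz) auto
    ultimately show ?thesis by simp
  qed
  show "c (m1, m2, m3) (1, 1, t) = 0"
  proof (cases m2)
    case 0
    then consider "m1 = 0" "m3 = t + 4" | "m1 = 1" "m3 = t + 3" using assms by auto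
    then show ?thesis
    proof cases
      case 1
      then show ?thesis using params 0 by simp
    next
      case 2
      have "c (0, 0, Suc (t + 3)) (0, 1, Suc t) = c (Suc 0, 0, t + 3) (Suc 0, 1, t)"
        by (rule slide_zx) auto
      moreover have "c (0, 0, Suc (t + 3)) (0, 1, Suc t) = 0" by (rule gen_yz) auto
      ultimately show ?thesis using 0 2 by simp
    qed
  next
    case (Suc k)
    have "c (m1, k, Suc m3) (1, 0, Suc t) = c (m1, Suc k, m3) (1, Suc 0, t)"
      by (rule slide_zy) (use assms Suc in auto)
    moreover have "c (m1, k, Suc m3) (1, 0, Suc t) = 0"
    proof (cases k)
      case 0
      then have "m1 = 0 \<and> Suc m3 = t + 4 \<or> m1 = 1 \<and> Suc m3 = t + 3" using assms Suc by auto
      then have "c (m1, 0, Suc m3) (1, 0, t + 1) = 0"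
        using params(6) xz10 by (elim disjE conjE) (simp_all only:)
      then show ?thesis using 0 by simp
    next
      case (Suc k')
      then show ?thesis using y[of m1 k' "Suc m3"] assms \<open>m2 = Suc k\<close> by auto
    qed
    ultimately show ?thesis using Suc by simp
  qed
qed

section \<open>Vanishing on all generators, then on the whole ideal\<close>

lemma min_gens_vanish:
  assumes g: "(m1, m2, m3) \<in> min_gens AE" and b: "(b1, b2, b3) \<notin> AE"
  shows "c (m1, m2, m3) (b1, b2, b3) = 0"
proof -
  have A: "(m1, m2, m3) \<in> AE" using g by (auto simp: min_gens_def)
  \<comment> \<open>All monomials of degree r outside E(d) lie in the socle, so the last case is
    void. In degree r - 1 the non-socle monomials are those in y and z together with xz^(t+1) and
    xyz^t.\<close>
  consider "b1 + b2 + b3 \<le> t + 1" | "(b1, b2, b3) \<in> socle AE"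
    | "b1 + b2 + b3 = t + 2" "(b1, b2, b3) \<notin> socle AE" | "b1 + b2 + b3 = t + 3" "(b1, b2, b3) \<notin> socle AE"
    using b by fastforce
  then show ?thesis
  proof cases
    case 1
    then show ?thesis using low_degree A by blast
  next
    case 2
    then show ?thesis using gens_socle g by blast
  next
    case 3
    then have bb: "b1 = 0 \<and> b2 + b3 = t + 2 \<or> b1 = 1 \<and> b2 = 0 \<and> b3 = t + 1 \<or> b1 = 1 \<and> b2 = 1 \<and> b3 = t"
      by (auto simp: socle_def)
    show ?thesis
    proof (cases "m1 + m2 + m3 = t + 3")
      case True
      then show ?thesis using degree_r_yz degree_r_xz degree_r_xyz A bb by auto
    next
      case False
      have "m1 = 0 \<and> m2 + m3 = t + 4 \<or> m1 = 1 \<and> m2 = 1 \<and> m3 = t + 2 \<or> m1 = 1 \<and> m2 = 0 \<and> m3 = t + 3"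
      proof -
        have x: "k + m2 + m3 \<le> t + 3 \<and> \<not> (k + m2 + m3 = t + 3 \<and> (2 \<le> k \<or> k = 1 \<and> 2 \<le> m2))"
          if "m1 = Suc k" for k
          using g that by (simp add: min_gens_def)
        have y: "m1 + k + m3 \<le> t + 3 \<and> \<not> (m1 + k + m3 = t + 3 \<and> (2 \<le> m1 \<or> m1 = 1 \<and> 2 \<le> k))"
          if "m2 = Suc k" for k
          using g that by (auto simp: min_gens_def)
        have z: "m1 + m2 + k \<le> t + 3 \<and> \<not> (m1 + m2 + k = t + 3 \<and> (2 \<le> m1 \<or> m1 = 1 \<and> 2 \<le> m2))"
          if "m3 = Suc k" for k
          using g that by (auto simp: min_gens_def)
        have d: "m1 + m2 + m3 = t + 4"
        proof -
          consider k where "m1 = Suc k" | k where "m2 = Suc k" | k where "m3 = Suc k"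
            using A by (cases m1; cases m2; cases m3) auto
          then have "m1 + m2 + m3 \<le> t + 4"
            using x y z by cases fastforce+
          then show ?thesis using A False by auto
        qed
        have "m1 \<le> 2"
        proof (rule ccontr)
          assume "\<not> m1 \<le> 2"
          then show False using x[of "m1 - 1"] d by auto
        qed
        moreover have "m1 \<noteq> 2"
        proof
          assume "m1 = 2"
          then show False using y[of "m2 - 1"] z[of "m3 - 1"] d by (cases m2; cases m3) auto
        qed
        moreover have "m2 \<le> 1" if "m1 = 1"
        proof (rule ccontr)
          assume "\<not> m2 \<le> 1"
          then show False using that y[of "m2 - 1"] z[of "m3 - 1"] d by (cases "m2 = 2"; cases m3) auto
        qed
        ultimately show ?thesis using d by linarith
      qed
      then show ?thesis using top_gens bb by auto
    qed
  next
    case 4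
    then show ?thesis using b by (auto simp: socle_def)
  qed
qed

end

text \<open>Dividing m by a variable inside A divides b by the same variable, or gives zero if b
  lacks it. Descending in the degree of m ends at a minimal generator.\<close>

lemma tangent_fun_vanish:
  assumes tf: "tangent_fun A c"
    and up: "\<And>a b e. (a, b, e) \<in> A \<Longrightarrow> (Suc a, b, e) \<in> A \<and> (a, Suc b, e) \<in> A \<and> (a, b, Suc e) \<in> A"
    and gens: "\<And>g b. \<lbrakk>g \<in> min_gens A; b \<notin> A\<rbrakk> \<Longrightarrow> c g b = 0"
    and "(m1, m2, m3) \<in> A" "(b1, b2, b3) \<notin> A"
  shows "c (m1, m2, m3) (b1, b2, b3) = 0"
  using assms(4,5)
proof (induction "m1 + m2 + m3" arbitrary: m1 m2 m3 b1 b2 b3)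
  case (0)
  then have "(m1, m2, m3) \<in> min_gens A" by (auto simp: min_gens_def)
  then show ?case using gens 0 by blast
next
  case (Suc n)
  interpret tangent_functions A c by unfold_locales (rule tf)
  consider "(m1, m2, m3) \<in> min_gens A"
    | k where "m1 = Suc k" "(k, m2, m3) \<in> A"
    | k where "m2 = Suc k" "(m1, k, m3) \<in> A"
    | k where "m3 = Suc k" "(m1, m2, k) \<in> A"
    using Suc.prems by (auto simp: min_gens_def)
  then show ?case
  proof cases
    case 1
    then show ?thesis using gens Suc.prems by blast
  next
    case (2 k)
    show ?thesis
    proof (cases b1)
      case 0
      then show ?thesis using dead_x 2 Suc.prems by simp
    next
      case (Suc l)
      then have "(l, b2, b3) \<notin> A" using up Suc.prems by blast
      then show ?thesis using shift_x[OF 2(2)] 2 Suc Suc.prems Suc.hyps(1)[of k m2 m3 l b2 b3] Suc.hyps(2) by simp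
    qed
  next
    case (3 k)
    show ?thesis
    proof (cases b2)
      case 0
      then show ?thesis using dead_y 3 Suc.prems by simp
    next
      case (Suc l)
      then have "(b1, l, b3) \<notin> A" using up Suc.prems by blast
      then show ?thesis using shift_y[OF 3(2)] 3 Suc Suc.prems Suc.hyps(1)[of m1 k m3 b1 l b3] Suc.hyps(2) by simp
    qed
  next
    case (4 k)
    show ?thesis
    proof (cases b3)
      case 0
      then show ?thesis using dead_z 4 Suc.prems by simp
    next
      case (Suc l)
      then have "(b1, b2, l) \<notin> A" using up Suc.prems by blast
      then show ?thesis using shift_z[OF 4(2)] 4 Suc Suc.prems Suc.hyps(1)[of m1 m2 k b1 b2 l] Suc.hyps(2) by simp
    qed
  qed
qed


section \<open>Monomial ideals\<close>

lemma poly3_sum_singles: "(\<Sum>m\<in>Poly_Mapping.keys p. Poly_Mapping.single m (Poly_Mapping.lookup p m)) = p"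
  by (rule poly_mapping_eqI)
    (simp add: lookup_sum lookup_single when_def in_keys_iff sum.delta)

lemma lookup_single_mult_shift:
  fixes p :: "'k::field poly3"
  shows "Poly_Mapping.lookup (Poly_Mapping.single u a * p) (u + m) = a * Poly_Mapping.lookup p m"
proof -
  have "Poly_Mapping.single u a * p =
      (\<Sum>n\<in>Poly_Mapping.keys p. Poly_Mapping.single (u + n) (a * Poly_Mapping.lookup p n))"
    by (subst (1) poly3_sum_singles[of p, symmetric]) (simp add: sum_distrib_left mult_single)
  then show ?thesis
    by (simp add: lookup_sum lookup_single when_def in_keys_iff sum.delta)
qed

lemma lookup_single_mult_zero:
  fixes p :: "'k::field poly3"
  assumes "\<And>m. b \<noteq> u + m"
  shows "Poly_Mapping.lookup (Poly_Mapping.single u a * p) b = 0"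
proof -
  have "b \<notin> Poly_Mapping.keys (Poly_Mapping.single u a * p)"
  proof
    assume "b \<in> Poly_Mapping.keys (Poly_Mapping.single u a * p)"
    then obtain v m where "b = v + m" "v \<in> Poly_Mapping.keys (Poly_Mapping.single u a)"
      using keys_mult[of "Poly_Mapping.single u a" p] by blast
    then show False using assms[of m] by (simp split: if_splits)
  qed
  then show ?thesis by (simp add: in_keys_iff)
qed

lemma lookup_const3_mult: "Poly_Mapping.lookup (const3 a * p) b = a * Poly_Mapping.lookup p b"
  using lookup_single_mult_shift[of 0 a p b] by (simp add: const3_def)

text \<open>Membership depends on the support alone, which turns sums, products and generation of
  monomial ideals into operations on sets of exponents.\<close>

definition mon_ideal :: "(nat \<times> nat \<times> nat) set \<Rightarrow> 'k::field poly3 set"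
  where "mon_ideal A = {p. Poly_Mapping.keys p \<subseteq> A}"

lemma mem_mon_ideal: "p \<in> mon_ideal A \<longleftrightarrow> (\<forall>b\<in>- A. Poly_Mapping.lookup p b = 0)"
  by (auto simp: mon_ideal_def in_keys_iff)

locale up_closed =
  fixes A :: "(nat \<times> nat \<times> nat) set"
  assumes up: "m \<in> A \<Longrightarrow> u + m \<in> A"
begin

lemma ideal_mon_ideal: "Ideal.ideal (mon_ideal A :: 'k::field poly3 set) SS"
proof (rule idealI)
  interpret SS: cring "SS :: 'k poly3 ring" by (rule cring_from_type_algebra)
  show "ring (SS :: 'k poly3 ring)" by (rule SS.ring_axioms)
  have neg: "\<ominus>\<^bsub>SS\<^esub> p = - p" for p :: "'k poly3"
    by (rule SS.minus_equality) auto
  show "subgroup (mon_ideal A) (add_monoid (SS :: 'k poly3 ring))"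
  proof (rule SS.add.subgroupI)
    have "0 \<in> (mon_ideal A :: 'k poly3 set)" by (simp add: mem_mon_ideal)
    then show "mon_ideal A \<noteq> ({} :: 'k poly3 set)" by blast
    show "\<ominus>\<^bsub>SS\<^esub> a \<in> mon_ideal A" if "a \<in> mon_ideal A" for a :: "'k poly3"
      using that by (simp add: neg mem_mon_ideal)
    show "a \<oplus>\<^bsub>SS\<^esub> b \<in> mon_ideal A"
      if "a \<in> mon_ideal A" "b \<in> mon_ideal A" for a b :: "'k poly3"
      using that by (simp add: mem_mon_ideal lookup_add)
  qed auto
  have l: "x * a \<in> mon_ideal A" if "a \<in> mon_ideal A" for a x :: "'k poly3"
    using keys_mult[of x a] that up by (force simp: mon_ideal_def)
  show "x \<otimes>\<^bsub>SS\<^esub> a \<in> mon_ideal A" "a \<otimes>\<^bsub>SS\<^esub> x \<in> mon_ideal A"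
    if "a \<in> mon_ideal A" for a x :: "'k poly3"
    using l[OF that, of x] by (simp_all add: mult.commute)
qed

end

text \<open>The ideal is a separate parameter, so that results apply to \<open>JJ r\<close> and
  \<open>EE d\<close> themselves once they are identified as monomial ideals.\<close>

locale mon_ideal3 = up_closed A for A +
  fixes I :: "'k::field poly3 set"
  assumes I_def: "I = mon_ideal A"
begin

sublocale ideal3 I
  by (rule ideal3.intro) (simp add: I_def ideal_mon_ideal)

lemma mem_I: "p \<in> I \<longleftrightarrow> (\<forall>b\<in>- A. Poly_Mapping.lookup p b = 0)"
  by (simp add: I_def mem_mon_ideal)

lemma single_mem: "m \<in> A \<Longrightarrow> Poly_Mapping.single m a \<in> I"
  by (auto simp: mem_I lookup_single when_def)

text \<open>Coefficients at exponents outside A agree on all representatives of a coset, so an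
  arbitrary choice suffices.\<close>

definition coord :: "nat \<times> nat \<times> nat \<Rightarrow> 'k poly3 set \<Rightarrow> 'k"
  where "coord b U = Poly_Mapping.lookup (SOME p. p \<in> U) b"

lemma coord_cos3: "b \<notin> A \<Longrightarrow> coord b (cos3 I p) = Poly_Mapping.lookup p b"
proof -
  assume b: "b \<notin> A"
  define q where "q = (SOME q. q \<in> cos3 I p)"
  have "q \<in> cos3 I p"
    unfolding q_def by (rule someI[of _ p]) (rule cos3_self)
  then show ?thesis
    using b unfolding coord_def q_def[symmetric] by (simp add: cos3_def mem_I lookup_minus)
qed

text \<open>The classes of the monomials outside A and the coefficient functionals at these
  monomials are dual families, and the functionals separate cosets.\<close>

lemma dim_quot_space:
  assumes fin: "finite (- A)"
  shows "vectorspace.fin_dim kk (quot_space I) \<and> vectorspace.dim kk (quot_space I) = card (- A)"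
proof -
  have lin: "lin_functional (quot_space I) (coord b)" if "b \<in> - A" for b
    using that by (auto simp: lin_functional_def coord_cos3 lookup_add lookup_const3_mult)
  have le: "vectorspace.fin_dim kk (quot_space I) \<and> vectorspace.dim kk (quot_space I) \<le> card (- A)"
  proof (rule dim_le_card_functionals[OF vectorspace_quot_space fin lin])
    fix u assume u: "u \<in> carrier (quot_space I)" and 0: "\<And>b. b \<in> - A \<Longrightarrow> coord b u = 0"
    then obtain p where p: "u = cos3 I p" by auto
    have "p \<in> I" using 0 by (simp add: p mem_I coord_cos3)
    then show "u = \<zero>\<^bsub>quot_space I\<^esub>" by (simp add: p cos3_eq)
  qed
  moreover have "card (- A) \<le> vectorspace.dim kk (quot_space I)"
  proof (rule card_dual_family_le_dim[OF vectorspace_quot_space _ fin lin,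
        where w = "\<lambda>b. cos3 I (Poly_Mapping.single b 1)"])
    show "coord b (cos3 I (Poly_Mapping.single b' 1)) = (if b = b' then 1 else 0)"
      if "b \<in> - A" for b b'
      using that coord_cos3[of b "Poly_Mapping.single b' 1"] by (simp add: lookup_single when_def)
  qed (use le in auto)
  ultimately show ?thesis by auto
qed

section \<open>Tangent vectors of a monomial ideal and their coefficient functions\<close>

definition ev :: "(nat \<times> nat \<times> nat) \<times> (nat \<times> nat \<times> nat) \<Rightarrow> ('k poly3 \<Rightarrow> 'k poly3 set) \<Rightarrow> 'k"
  where "ev x f = coord (snd x) (f (Poly_Mapping.single (fst x) 1))"

lemma lin_functional_ev:
  assumes "m \<in> A" "b \<notin> A"
  shows "lin_functional (tangent_space I) (ev (m, b))"
  using assms single_mem[OF assms(1), of 1]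
  by (auto simp: lin_functional_def ev_def tangent_repr tangent_space_simps coord_cos3 lookup_add
      lookup_const3_mult)

lemma tangent_fun_ev:
  assumes f: "f \<in> carrier (tangent_space I)"
  shows "tangent_fun A (\<lambda>m b. ev (m, b) f)"
proof -
  from f obtain F where F: "f = (\<lambda>p\<in>I. cos3 I (F p))" "\<forall>a. \<forall>p\<in>I. F (a * p) - a * F p \<in> I"
    unfolding tangent_repr by blast
  have ev: "ev (m, b) f = Poly_Mapping.lookup (F (Poly_Mapping.single m 1)) b"
    if "m \<in> A" "b \<notin> A" for m b
    using that single_mem[of m 1] by (simp add: ev_def F(1) coord_cos3)
  have step: "ev (u + m, b) f =
      Poly_Mapping.lookup (Poly_Mapping.single u 1 * F (Poly_Mapping.single m 1)) b"
    if "m \<in> A" "b \<notin> A" for u m b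
  proof -
    have "F (Poly_Mapping.single u 1 * Poly_Mapping.single m 1)
        - Poly_Mapping.single u 1 * F (Poly_Mapping.single m 1) \<in> I"
      using F(2) single_mem[OF that(1)] by blast
    then show ?thesis using that up[OF that(1), of u] by (simp add: mem_I ev lookup_minus mult_single)
  qed
  have shift: "ev (u + m, u + b) f = ev (m, b) f" if "m \<in> A" "u + b \<notin> A" for u m b
  proof -
    have "b \<notin> A" using that up by blast
    then show ?thesis using that step[of m "u + b" u] ev[of m b] by (simp add: lookup_single_mult_shift)
  qed
  have zero: "ev (u + m, b) f = 0" if "m \<in> A" "b \<notin> A" "\<And>b'. b \<noteq> u + b'" for u m b
    using that step[of m b u] by (simp add: lookup_single_mult_zero)
  show ?thesis
    unfolding tangent_fun_def
    using shift[of _ "(1, 0, 0)"] shift[of _ "(0, 1, 0)"] shift[of _ "(0, 0, 1)"]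
      zero[of _ _ "(1, 0, 0)"] zero[of _ _ "(0, 1, 0)"] zero[of _ _ "(0, 0, 1)"]
    by auto
qed

lemma tangent_eq_zero:
  assumes f: "f \<in> carrier (tangent_space I)"
    and 0: "\<And>m b. \<lbrakk>m \<in> A; b \<notin> A\<rbrakk> \<Longrightarrow> ev (m, b) f = 0"
  shows "f = \<zero>\<^bsub>tangent_space I\<^esub>"
proof -
  from f obtain F where F: "f = (\<lambda>p\<in>I. cos3 I (F p))"
    "\<forall>p\<in>I. \<forall>q\<in>I. F (p + q) - (F p + F q) \<in> I" "\<forall>a. \<forall>p\<in>I. F (a * p) - a * F p \<in> I"
    unfolding tangent_repr by blast
  have F1: "F (Poly_Mapping.single m 1) \<in> I" if "m \<in> A" for m
    using 0[OF that] single_mem[OF that, of 1] by (simp add: ev_def F(1) coord_cos3 mem_I)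
  have Fa: "F (Poly_Mapping.single m a) \<in> I" if "m \<in> A" for m a
  proof -
    have "F (const3 a * Poly_Mapping.single m 1) - const3 a * F (Poly_Mapping.single m 1) \<in> I"
      using F(3) single_mem[OF that] by blast
    then show ?thesis
      using add_mem mult_mem[OF F1[OF that], of "const3 a"] by (fastforce simp: const3_def mult_single)
  qed
  \<comment> \<open>The second conjunct keeps the partial sums inside I, where F is known to be
    additive modulo I.\<close>
  have FS: "F (\<Sum>m\<in>S. Poly_Mapping.single m (h m)) \<in> I \<and> (\<Sum>m\<in>S. Poly_Mapping.single m (h m)) \<in> I"
    if "finite S" "S \<subseteq> A" for S h
    using that
  proof (induction S)
    case empty
    have "F (0 * 0) - 0 * F 0 \<in> I" using F(3) zero_mem by blast
    then show ?case by simp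
  next
    case (insert m S)
    let ?s = "\<Sum>m\<in>S. Poly_Mapping.single m (h m)"
    have m: "Poly_Mapping.single m (h m) \<in> I" using insert single_mem by auto
    have "F (Poly_Mapping.single m (h m) + ?s) - (F (Poly_Mapping.single m (h m)) + F ?s) \<in> I"
      using F(2) m insert by auto
    moreover have "F (Poly_Mapping.single m (h m)) + F ?s \<in> I"
      using insert Fa add_mem by auto
    ultimately have "F (Poly_Mapping.single m (h m) + ?s) \<in> I"
      using add_mem by fastforce
    then show ?case using insert m add_mem by simp
  qed
  have FI: "F p \<in> I" if "p \<in> I" for p
  proof -
    have "Poly_Mapping.keys p \<subseteq> A" using that by (simp add: I_def mon_ideal_def)
    from this[THEN FS[OF finite_keys], of "Poly_Mapping.lookup p", THEN conjunct1]
    show ?thesis by (simp only: poly3_sum_singles)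
  qed
  show ?thesis
    unfolding tangent_space_simps F(1) using FI by (auto simp: cos3_eq fun_eq_iff)
qed

lemma dim_tangent_space_le:
  assumes fin: "finite P" and P: "P \<subseteq> A \<times> - A"
    and det: "\<And>c :: nat \<times> nat \<times> nat \<Rightarrow> nat \<times> nat \<times> nat \<Rightarrow> 'k.
      \<lbrakk>tangent_fun A c; \<And>m b. (m, b) \<in> P \<Longrightarrow> c m b = 0\<rbrakk> \<Longrightarrow> (\<forall>m\<in>A. \<forall>b\<in>- A. c m b = 0)"
  shows "vectorspace.fin_dim kk (tangent_space I) \<and> vectorspace.dim kk (tangent_space I) \<le> card P"
proof (rule dim_le_card_functionals[OF vectorspace_tangent_space fin])
  show "lin_functional (tangent_space I) (ev x)" if "x \<in> P" for x
    using that P lin_functional_ev by (cases x) auto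
  show "f = \<zero>\<^bsub>tangent_space I\<^esub>"
    if f: "f \<in> carrier (tangent_space I)" "\<And>x. x \<in> P \<Longrightarrow> ev x f = 0" for f
    using det[OF tangent_fun_ev[OF f(1)]] f by (intro tangent_eq_zero) auto
qed

text \<open>Iterates the one-variable relations, one variable after the other; up-closedness of A
  keeps the intermediate exponents on the right side. If b is not divisible by u, some exponent of b
  is smaller than that of u: cancelling all of b in this variable leads to a zero relation.\<close>

lemma tangent_fun_shift:
  assumes c: "tangent_fun A c" and m: "m \<in> A"
  shows "u + b \<notin> A \<Longrightarrow> c (u + m) (u + b) = c m b"
    and "b \<notin> A \<Longrightarrow> (\<And>b'. b \<noteq> u + b') \<Longrightarrow> c (u + m) b = (0 :: 'k)"
proof -
  interpret tangent_functions A c by unfold_locales (rule c)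
  have up3: "(k1 + m1, k2 + m2, k3 + m3) \<in> A" if "(m1, m2, m3) \<in> A" for k1 k2 k3 m1 m2 m3
    using up[OF that, of "(k1, k2, k3)"] by simp
  have dn3: "(m1, m2, m3) \<notin> A" if "(k1 + m1, k2 + m2, k3 + m3) \<notin> A" for k1 k2 k3 m1 m2 m3
    using up3 that by blast
  have x: "c (k + m1, m2, m3) (k + b1, b2, b3) = c (m1, m2, m3) (b1, b2, b3)"
    if "(m1, m2, m3) \<in> A" "(k + b1, b2, b3) \<notin> A" for k m1 m2 m3 b1 b2 b3
    using that
  proof (induction k)
    case (Suc k)
    then show ?case
      using shift_x[OF up3[OF Suc.prems(1), of k 0 0], of "k + b1" b2 b3]
        dn3[of 1 "k + b1" 0 b2 0 b3] by simp
  qed simp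
  have y: "c (m1, k + m2, m3) (b1, k + b2, b3) = c (m1, m2, m3) (b1, b2, b3)"
    if "(m1, m2, m3) \<in> A" "(b1, k + b2, b3) \<notin> A" for k m1 m2 m3 b1 b2 b3
    using that
  proof (induction k)
    case (Suc k)
    then show ?case
      using shift_y[OF up3[OF Suc.prems(1), of 0 k 0], of b1 "k + b2" b3]
        dn3[of 0 b1 1 "k + b2" 0 b3] by simp
  qed simp
  have z: "c (m1, m2, k + m3) (b1, b2, k + b3) = c (m1, m2, m3) (b1, b2, b3)"
    if "(m1, m2, m3) \<in> A" "(b1, b2, k + b3) \<notin> A" for k m1 m2 m3 b1 b2 b3
    using that
  proof (induction k)
    case (Suc k)
    then show ?case
      using shift_z[OF up3[OF Suc.prems(1), of 0 0 k], of b1 b2 "k + b3"]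
        dn3[of 0 b1 0 b2 1 "k + b3"] by simp
  qed simp
  obtain u1 u2 u3 where u: "u = (u1, u2, u3)" by (rule prod_cases3)
  obtain m1 m2 m3 where m': "m = (m1, m2, m3)" by (rule prod_cases3)
  obtain b1 b2 b3 where b': "b = (b1, b2, b3)" by (rule prod_cases3)
  note d = u m' b'
  have mA: "(m1, m2, m3) \<in> A" using m d by simp
  show "c (u + m) (u + b) = c m b" if "u + b \<notin> A"
  proof -
    have n: "(u1 + b1, u2 + b2, u3 + b3) \<notin> A" using that d by simp
    have "c (u1 + m1, u2 + m2, u3 + m3) (u1 + b1, u2 + b2, u3 + b3) =
        c (m1, u2 + m2, u3 + m3) (b1, u2 + b2, u3 + b3)"
      by (rule x) (use up3[OF mA, of 0 u2 u3] n in auto)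
    also have "\<dots> = c (m1, m2, u3 + m3) (b1, b2, u3 + b3)"
      by (rule y) (use up3[OF mA, of 0 0 u3] dn3[of u1 b1 0 "u2 + b2" 0 "u3 + b3"] n in auto)
    also have "\<dots> = c (m1, m2, m3) (b1, b2, b3)"
      by (rule z) (use mA dn3[of u1 b1 u2 b2 0 "u3 + b3"] n in auto)
    finally show ?thesis using d by simp
  qed
  show "c (u + m) b = 0" if b: "b \<notin> A" and nle: "\<And>b'. b \<noteq> u + b'"
  proof -
    have bA: "(b1, b2, b3) \<notin> A" using b d by simp
    have "b1 < u1 \<or> b2 < u2 \<or> b3 < u3"
      using nle[of "(b1 - u1, b2 - u2, b3 - u3)"] d by auto
    then consider k where "u1 = b1 + Suc k" | k where "u2 = b2 + Suc k" | k where "u3 = b3 + Suc k"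
      by (auto dest!: less_imp_Suc_add)
    then show ?thesis
    proof cases
      case (1 k)
      have "c (b1 + (Suc k + m1), u2 + m2, u3 + m3) (b1 + 0, b2, b3) =
          c (Suc k + m1, u2 + m2, u3 + m3) (0, b2, b3)"
        by (rule x) (use bA up3[OF mA, of "Suc k" u2 u3] in auto)
      also have "\<dots> = 0"
        using dead_x[of "k + m1" "u2 + m2" "u3 + m3" b2 b3] up3[OF mA, of k u2 u3]
          dn3[of b1 0 0 b2 0 b3] bA by simp
      finally show ?thesis using 1 d by (simp add: add.assoc)
    next
      case (2 k)
      have "c (u1 + m1, b2 + (Suc k + m2), u3 + m3) (b1, b2 + 0, b3) =
          c (u1 + m1, Suc k + m2, u3 + m3) (b1, 0, b3)"
        by (rule y) (use bA up3[OF mA, of u1 "Suc k" u3] in auto)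
      also have "\<dots> = 0"
        using dead_y[of "u1 + m1" "k + m2" "u3 + m3" b1 b3] up3[OF mA, of u1 k u3]
          dn3[of 0 b1 b2 0 0 b3] bA by simp
      finally show ?thesis using 2 d by (simp add: add.assoc)
    next
      case (3 k)
      have "c (u1 + m1, u2 + m2, b3 + (Suc k + m3)) (b1, b2, b3 + 0) =
          c (u1 + m1, u2 + m2, Suc k + m3) (b1, b2, 0)"
        by (rule z) (use bA up3[OF mA, of u1 u2 "Suc k"] in auto)
      also have "\<dots> = 0"
        using dead_z[of "u1 + m1" "u2 + m2" "k + m3" b1 b2] up3[OF mA, of u1 u2 k]
          dn3[of 0 b1 0 b2 b3 0] bA by simp
      finally show ?thesis using 3 d by (simp add: add.assoc)
    qed
  qed
qed

text \<open>Extends c linearly from monomials, keeping only the finitely many target monomials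
  outside A. S-linearity modulo I is bilinear in the two factors, hence reduces to single terms,
  where it is \<open>tangent_fun_shift\<close>.\<close>

lemma tangent_of_fun:
  assumes fin: "finite (- A)" and c: "tangent_fun A c"
  shows "\<exists>f\<in>carrier (tangent_space I). \<forall>m\<in>A. \<forall>b\<in>- A. ev (m, b) f = c m b"
proof -
  define G where "G p b = (\<Sum>m\<in>Poly_Mapping.keys p. Poly_Mapping.lookup p m * c m b)" for p b
  define F where "F p = (\<Sum>b\<in>- A. Poly_Mapping.single b (G p b))" for p
  have lookF: "Poly_Mapping.lookup (F p) b = G p b" if "b \<notin> A" for p b
    using that fin by (simp add: F_def lookup_sum lookup_single when_def sum.delta)
  have Gs: "G p b = (\<Sum>m\<in>S. Poly_Mapping.lookup p m * c m b)"
    if "finite S" "Poly_Mapping.keys p \<subseteq> S" for p b S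
    unfolding G_def by (rule sum.mono_neutral_left) (use that in \<open>auto simp: in_keys_iff\<close>)
  have Gadd: "G (p + q) b = G p b + G q b" for p q b
    using Gs[of "Poly_Mapping.keys p \<union> Poly_Mapping.keys q"] keys_add[of p q]
    by (simp add: lookup_add algebra_simps sum.distrib)
  have Fadd: "F (p + q) = F p + F q" for p q
    by (simp add: F_def Gadd single_add sum.distrib)
  have F0: "F 0 = 0" by (simp add: F_def G_def)
  have Fsum: "F (sum h S) = (\<Sum>i\<in>S. F (h i))" for h :: "(nat \<times> nat \<times> nat) \<Rightarrow> 'k poly3" and S
    by (induction S rule: infinite_finite_induct) (simp_all add: F0 Fadd)
  have Gsingle: "G (Poly_Mapping.single m a) b = a * c m b" for m a b
    by (simp add: G_def)
  have ss: "F (Poly_Mapping.single u a * Poly_Mapping.single m e) -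
      Poly_Mapping.single u a * F (Poly_Mapping.single m e) \<in> I" if m: "m \<in> A" for u a m e
  proof -
    have "Poly_Mapping.lookup (F (Poly_Mapping.single u a * Poly_Mapping.single m e) -
      Poly_Mapping.single u a * F (Poly_Mapping.single m e)) b = 0" if b: "b \<notin> A" for b
    proof (cases "\<exists>b'. b = u + b'")
      case True
      then obtain b' where b': "b = u + b'" by blast
      then have "b' \<notin> A" using b up by blast
      then show ?thesis
        using tangent_fun_shift(1)[OF c m, of u b'] b b'
        by (simp add: lookup_minus lookup_single_mult_shift mult_single lookF Gsingle)
    next
      case False
      then have nb: "\<And>b'. b \<noteq> u + b'" by blast
      show ?thesis
        using tangent_fun_shift(2)[OF c m b nb] lookup_single_mult_zero[OF nb] b
        by (simp add: lookup_minus mult_single lookF Gsingle)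
    qed
    then show ?thesis by (simp add: mem_I)
  qed
  have sum_mem: "(\<Sum>i\<in>S. h i) \<in> I" if "\<And>i. i \<in> S \<Longrightarrow> h i \<in> I"
    for h :: "(nat \<times> nat \<times> nat) \<Rightarrow> 'k poly3" and S
    using that by (induction S rule: infinite_finite_induct) (auto intro: add_mem)
  have mult: "F (q * p) - q * F p \<in> I" if p: "p \<in> I" for p q
  proof -
    let ?q = "\<lambda>u. Poly_Mapping.single u (Poly_Mapping.lookup q u)"
    let ?p = "\<lambda>m. Poly_Mapping.single m (Poly_Mapping.lookup p m)"
    have "F (q * p) = F ((\<Sum>u\<in>Poly_Mapping.keys q. ?q u) * (\<Sum>m\<in>Poly_Mapping.keys p. ?p m))"
      by (simp only: poly3_sum_singles)
    also have "\<dots> = (\<Sum>u\<in>Poly_Mapping.keys q. \<Sum>m\<in>Poly_Mapping.keys p. F (?q u * ?p m))"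
      by (simp only: sum_product Fsum)
    finally have 1: "F (q * p) = \<dots>" .
    have "q * F p = (\<Sum>u\<in>Poly_Mapping.keys q. ?q u) * F (\<Sum>m\<in>Poly_Mapping.keys p. ?p m)"
      by (simp only: poly3_sum_singles)
    also have "\<dots> = (\<Sum>u\<in>Poly_Mapping.keys q. \<Sum>m\<in>Poly_Mapping.keys p. ?q u * F (?p m))"
      by (simp only: sum_product Fsum)
    finally have 2: "q * F p = \<dots>" .
    have pA: "Poly_Mapping.keys p \<subseteq> A" using p by (simp add: I_def mon_ideal_def)
    show ?thesis
      unfolding 1 2 sum_subtractf[symmetric] by (intro sum_mem ss) (use pA in auto)
  qed
  define f where "f = (\<lambda>p\<in>I. cos3 I (F p))"
  have "f \<in> carrier (tangent_space I)"
    unfolding tangent_repr f_def using mult Fadd by (intro exI[of _ F]) auto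
  moreover have "ev (m, b) f = c m b" if "m \<in> A" "b \<in> - A" for m b
    using that single_mem[of m 1] by (simp add: f_def ev_def coord_cos3 lookF Gsingle)
  ultimately show ?thesis by blast
qed

text \<open>Each pair in Q serves twice: as the index of a tangent vector and as the coordinate that
  detects it.\<close>

lemma card_le_dim_tangent_space:
  assumes fd: "vectorspace.fin_dim kk (tangent_space I)"
    and finA: "finite (- A)" and fin: "finite Q" and Q: "Q \<subseteq> A \<times> - A"
    and c: "\<And>x. x \<in> Q \<Longrightarrow> tangent_fun A (c x)"
    and dual: "\<And>x m b. \<lbrakk>x \<in> Q; (m, b) \<in> Q\<rbrakk> \<Longrightarrow> c x m b = (if (m, b) = x then 1 else 0 :: 'k)"
  shows "card Q \<le> vectorspace.dim kk (tangent_space I)"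
proof -
  have "\<forall>x\<in>Q. \<exists>f. f \<in> carrier (tangent_space I) \<and> (\<forall>m\<in>A. \<forall>b\<in>- A. ev (m, b) f = c x m b)"
    using tangent_of_fun[OF finA c] by blast
  then obtain w where w: "\<And>x. x \<in> Q \<Longrightarrow> w x \<in> carrier (tangent_space I)"
    "\<And>x m b. \<lbrakk>x \<in> Q; m \<in> A; b \<in> - A\<rbrakk> \<Longrightarrow> ev (m, b) (w x) = c x m b"
    by metis
  show ?thesis
  proof (rule card_dual_family_le_dim[OF vectorspace_tangent_space fd fin, where \<phi> = ev and w = w])
    show "lin_functional (tangent_space I) (ev x)" if "x \<in> Q" for x
      using that Q lin_functional_ev by (cases x) auto
    show "w x \<in> carrier (tangent_space I)" if "x \<in> Q" for x using that by (rule w)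
    show "ev x (w y) = (if x = y then 1 else 0)" if xy: "x \<in> Q" "y \<in> Q" for x y
    proof -
      obtain m b where x: "x = (m, b)" by (rule prod.exhaust)
      then have "m \<in> A" "b \<in> - A" using xy(1) Q by auto
      then show ?thesis using w(2)[OF xy(2)] dual[OF xy(2)] xy(1) unfolding x by simp
    qed
  qed
qed

end


section \<open>Generators and socles of the two ideals\<close>

text \<open>The exponents of the monomials in \<open>J\<close>.\<close>

definition expJ :: "nat \<Rightarrow> (nat \<times> nat \<times> nat) set"
  where "expJ r = {(a, b, c). a + b + c = r \<and> (2 \<le> a \<or> a = 1 \<and> 1 \<le> b)
    \<or> a + b + c = r + 1 \<and> \<not> (a = 0 \<and> b = 0) \<or> r + 2 \<le> a + b + c}"

lemma expE_iff: "(a, b, c) \<in> expE r \<longleftrightarrow> r < a + b + c \<or> a + b + c = r \<and> (2 \<le> a \<or> a = 1 \<and> 2 \<le> b)"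
  by (simp add: expE_def)

lemma expJ_iff: "(a, b, c) \<in> expJ r \<longleftrightarrow> a + b + c = r \<and> (2 \<le> a \<or> a = 1 \<and> 1 \<le> b)
    \<or> a + b + c = r + 1 \<and> \<not> (a = 0 \<and> b = 0) \<or> r + 2 \<le> a + b + c"
  by (simp add: expJ_def)

lemma up_closed_expE: "up_closed (expE r)"
proof
  fix m u :: "nat \<times> nat \<times> nat"
  obtain m1 m2 m3 where m: "m = (m1, m2, m3)" by (rule prod_cases3)
  obtain u1 u2 u3 where u: "u = (u1, u2, u3)" by (rule prod_cases3)
  show "m \<in> expE r \<Longrightarrow> u + m \<in> expE r" unfolding m u plus_prod_def by (auto simp: expE_iff)
qed

lemma up_closed_expJ: "up_closed (expJ r)"
proof
  fix m u :: "nat \<times> nat \<times> nat"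
  obtain m1 m2 m3 where m: "m = (m1, m2, m3)" by (rule prod_cases3)
  obtain u1 u2 u3 where u: "u = (u1, u2, u3)" by (rule prod_cases3)
  show "m \<in> expJ r \<Longrightarrow> u + m \<in> expJ r" unfolding m u plus_prod_def by (auto simp: expJ_iff)
qed

lemma nat_cases3:
  obtains "n = 0" | "n = Suc 0" | "n = Suc (Suc 0)" | k where "n = Suc (Suc (Suc k))"
  by (metis not0_implies_Suc)

lemma min_gens_expE: "(a, b, e) \<in> min_gens (expE (t + 3)) \<longleftrightarrow>
    a + b + e = t + 3 \<and> (2 \<le> a \<or> a = 1 \<and> 2 \<le> b) \<or> a + b + e = t + 4 \<and> (a = 0 \<or> a = 1 \<and> b \<le> 1)"
  by (cases a rule: nat_cases3; cases b rule: nat_cases3; cases e; hypsubst)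
    (simp_all add: min_gens_def expE_iff, linarith+)

lemma min_gens_expJ: "(a, b, e) \<in> min_gens (expJ (t + 3)) \<longleftrightarrow>
    a + b + e = t + 3 \<and> (2 \<le> a \<or> a = 1 \<and> 1 \<le> b) \<or>
    a + b + e = t + 4 \<and> (a = 0 \<and> 1 \<le> b \<or> a = 1 \<and> b = 0) \<or> a = 0 \<and> b = 0 \<and> e = t + 5"
  by (cases a rule: nat_cases3; cases b rule: nat_cases3; cases e; hypsubst)
    (simp_all add: min_gens_def expJ_iff, linarith+)

lemma socle_expE: "(a, b, e) \<in> socle (expE (t + 3)) \<longleftrightarrow>
    a + b + e = t + 3 \<and> \<not> (2 \<le> a \<or> a = 1 \<and> 2 \<le> b) \<or> a + b + e = t + 2 \<and> (2 \<le> a \<or> a = 1 \<and> 2 \<le> b)"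
  by (cases a rule: nat_cases3; cases b rule: nat_cases3; hypsubst)
    (simp_all add: socle_def expE_iff, linarith+)

lemma socle_expJ: "(a, b, e) \<in> socle (expJ (t + 3)) \<longleftrightarrow>
    a = 0 \<and> b = 0 \<and> e = t + 4 \<or> a + b + e = t + 3 \<and> (a = 1 \<and> b = 0 \<or> a = 0 \<and> 1 \<le> b) \<or>
    a + b + e = t + 2 \<and> (2 \<le> a \<or> a = 1 \<and> 1 \<le> b)"
  by (cases a rule: nat_cases3; cases b rule: nat_cases3; hypsubst)
    (simp_all add: socle_def expJ_iff, linarith+)

section \<open>Finiteness and counting\<close>

lemma finite_exps_le: "finite {(a, b, c). a + b + c \<le> (n :: nat)}"
  by (rule finite_subset[of _ "{..n} \<times> {..n} \<times> {..n}"]) auto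

lemma finite_compl_expE: "finite (- expE r)"
  by (rule finite_subset[OF _ finite_exps_le[of r]]) (auto simp: expE_def)

lemma finite_compl_expJ: "finite (- expJ r)"
  by (rule finite_subset[OF _ finite_exps_le[of "r + 1"]]) (auto simp: expJ_def)

lemma finite_min_gens: "finite (min_gens (expE (t + 3)))" "finite (min_gens (expJ (t + 3)))"
  by (rule finite_subset[OF _ finite_exps_le[of "t + 5"]], auto simp: min_gens_expE min_gens_expJ)+

lemma finite_socle: "finite (- A) \<Longrightarrow> finite (socle A)"
  by (rule finite_subset) (auto simp: socle_def)

text \<open>Admitting xyz^(t+1) to the ideal replaces the generator xyz^(t+2) by a divisor;
  expelling z^(t+4) replaces it by z^(t+5). All other generators agree.\<close>

lemma card_min_gens: "card (min_gens (expE (t + 3))) = card (min_gens (expJ (t + 3)))"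
proof -
  define G where "G = {(a, b, e). a + b + e = t + 3 \<and> (2 \<le> a \<or> a = 1 \<and> 2 \<le> b) \<or>
    a + b + e = t + 4 \<and> (a = 0 \<and> 1 \<le> b \<or> a = 1 \<and> b = 0)}"
  have E: "min_gens (expE (t + 3)) = {(1, 1, t + 2), (0, 0, t + 4)} \<union> G"
  proof (rule Set.set_eqI)
    fix x show "x \<in> min_gens (expE (t + 3)) \<longleftrightarrow> x \<in> {(1, 1, t + 2), (0, 0, t + 4)} \<union> G"
    proof (cases x)
      case (fields a b e)
      show ?thesis unfolding fields
        by (cases a rule: nat_cases3; cases b rule: nat_cases3; hypsubst) (auto simp: G_def min_gens_expE)
    qed
  qed
  have J: "min_gens (expJ (t + 3)) = {(1, 1, t + 1), (0, 0, t + 5)} \<union> G"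
  proof (rule Set.set_eqI)
    fix x show "x \<in> min_gens (expJ (t + 3)) \<longleftrightarrow> x \<in> {(1, 1, t + 1), (0, 0, t + 5)} \<union> G"
    proof (cases x)
      case (fields a b e)
      show ?thesis unfolding fields
        by (cases a rule: nat_cases3; cases b rule: nat_cases3; hypsubst) (auto simp: G_def min_gens_expJ)
    qed
  qed
  have fin: "finite G"
    by (rule finite_subset[OF _ finite_exps_le[of "t + 4"]]) (auto simp: G_def)
  have "card (min_gens (expE (t + 3))) = 2 + card G"
    by (subst E, subst card_Un_disjoint) (use fin in \<open>auto simp: G_def\<close>)
  moreover have "card (min_gens (expJ (t + 3))) = 2 + card G"
    by (subst J, subst card_Un_disjoint) (use fin in \<open>auto simp: G_def\<close>)
  ultimately show ?thesis by simp
qed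

text \<open>The exchange seen from outside the ideal: xyz^(t+1) drops to xyz^t and z^(t+3) rises to
  z^(t+4).\<close>

lemma card_socle: "card (socle (expE (t + 3))) = card (socle (expJ (t + 3)))"
proof -
  define G where "G = {(a, b, e). a + b + e = t + 3 \<and> (a = 1 \<and> b = 0 \<or> a = 0 \<and> 1 \<le> b) \<or>
    a + b + e = t + 2 \<and> (2 \<le> a \<or> a = 1 \<and> 2 \<le> b)}"
  have E: "socle (expE (t + 3)) = {(1, 1, t + 1), (0, 0, t + 3)} \<union> G"
  proof (rule Set.set_eqI)
    fix x show "x \<in> socle (expE (t + 3)) \<longleftrightarrow> x \<in> {(1, 1, t + 1), (0, 0, t + 3)} \<union> G"
    proof (cases x)
      case (fields a b e)
      show ?thesis unfolding fields
        by (cases a rule: nat_cases3; cases b rule: nat_cases3; hypsubst) (auto simp: G_def socle_expE)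
    qed
  qed
  have J: "socle (expJ (t + 3)) = {(0, 0, t + 4), (1, 1, t)} \<union> G"
  proof (rule Set.set_eqI)
    fix x show "x \<in> socle (expJ (t + 3)) \<longleftrightarrow> x \<in> {(0, 0, t + 4), (1, 1, t)} \<union> G"
    proof (cases x)
      case (fields a b e)
      show ?thesis unfolding fields
        by (cases a rule: nat_cases3; cases b rule: nat_cases3; hypsubst) (auto simp: G_def socle_expJ)
    qed
  qed
  have fin: "finite G"
    by (rule finite_subset[OF _ finite_exps_le[of "t + 4"]]) (auto simp: G_def)
  have "card (socle (expE (t + 3))) = 2 + card G"
    by (subst E, subst card_Un_disjoint) (use fin in \<open>auto simp: G_def\<close>)
  moreover have "card (socle (expJ (t + 3))) = 2 + card G"
    by (subst J, subst card_Un_disjoint) (use fin in \<open>auto simp: G_def\<close>)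
  ultimately show ?thesis by simp
qed


text \<open>Monomials of degree n + 1 divisible by x correspond to those of degree n, and n + 2
  further ones involve only y and z; Pascal's rule adds the counts.\<close>

lemma card_exps3: "finite (exps3 n) \<and> card (exps3 n) = (n + 2) choose 2"
proof (induction n)
  case 0
  have "exps3 0 = {(0, 0, 0)}" by (auto simp: exps3_def)
  then show ?case by (simp add: numeral_2_eq_2)
next
  case (Suc n)
  let ?f = "\<lambda>(a, b, c). (Suc a, b, c)" and ?g = "\<lambda>b. (0, b, Suc n - b)"
  have "x \<in> exps3 (Suc n) \<longleftrightarrow> x \<in> ?f ` exps3 n \<union> ?g ` {..Suc n}" for x
  proof (cases x)
    case (fields a b c)
    then show ?thesis by (cases a) (auto simp: exps3_def image_iff)
  qed
  then have E: "exps3 (Suc n) = ?f ` exps3 n \<union> ?g ` {..Suc n}" by blast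
  have "card (?f ` exps3 n) = card (exps3 n)" by (rule card_image) (auto simp: inj_on_def)
  moreover have "card (?g ` {..Suc n}) = n + 2" by (subst card_image) (auto simp: inj_on_def)
  moreover have "?f ` exps3 n \<inter> ?g ` {..Suc n} = {}" by auto
  ultimately have "card (exps3 (Suc n)) = ((n + 2) choose 2) + (n + 2)"
    unfolding E using Suc by (subst card_Un_disjoint) auto
  moreover have "(Suc n + 2) choose 2 = ((n + 2) choose 2) + (n + 2)"
    by (simp add: numeral_2_eq_2)
  ultimately show ?case using Suc by (simp add: E)
qed

lemma card_exps_less:
  "finite {(a, b, c). a + b + c < n} \<and> card {(a, b, c). a + b + c < (n :: nat)} = (n + 2) choose 3"
proof (induction n)
  case (Suc n)
  have E: "{(a, b, c). a + b + c < Suc n} = {(a, b, c). a + b + c < n} \<union> exps3 n"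
    by (auto simp: exps3_def)
  have "card {(a, b, c). a + b + c < Suc n} = ((n + 2) choose 3) + ((n + 2) choose 2)"
    unfolding E by (subst card_Un_disjoint) (use Suc card_exps3[of n] in \<open>auto simp: exps3_def\<close>)
  moreover have "(Suc n + 2) choose 3 = ((n + 2) choose 2) + ((n + 2) choose 3)"
    by (simp add: numeral_3_eq_3 numeral_2_eq_2)
  ultimately show ?case using Suc card_exps3[of n] by (simp add: E)
qed simp

lemma card_compl:
  "card (- expE (t + 3)) = ((t + 5) choose 3) + t + 6"
  "card (- expJ (t + 3)) = ((t + 5) choose 3) + t + 6"
proof -
  \<comment> \<open>Both complements contain all monomials of degree below r and the r + 1 monomials
    of degree r in y and z; each has exactly two more.\<close>
  let ?D = "{(a, b, c). a + b + c < t + 3}" and ?Y = "(\<lambda>j. (0, j, t + 3 - j)) ` {..t + 3}"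
  have D: "finite ?D" "card ?D = (t + 5) choose 3" using card_exps_less[of "t + 3"] by (simp_all add: add.commute)
  have Y: "finite ?Y" "card ?Y = t + 4" by (simp, subst card_image) (auto simp: inj_on_def)
  have DY: "card (?D \<union> ?Y) = ((t + 5) choose 3) + t + 4"
    by (subst card_Un_disjoint) (use D Y in auto)
  have E: "- expE (t + 3) = {(1, 0, t + 2), (1, 1, t + 1)} \<union> (?D \<union> ?Y)"
    by (auto simp: expE_iff image_iff)
  show "card (- expE (t + 3)) = ((t + 5) choose 3) + t + 6"
    unfolding E by (subst card_Un_disjoint) (use D Y DY in auto)
  have J: "- expJ (t + 3) = {(1, 0, t + 2), (0, 0, t + 4)} \<union> (?D \<union> ?Y)"
    by (auto simp: expJ_iff image_iff)
  show "card (- expJ (t + 3)) = ((t + 5) choose 3) + t + 6"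
    unfolding J by (subst card_Un_disjoint) (use D Y DY in auto)
qed

section \<open>Explicit tangent vectors and the two dimension bounds\<close>

lemma min_gens_subset: "min_gens A \<subseteq> A"
  by (auto simp: min_gens_def)

lemma socle_subset: "socle A \<subseteq> - A"
  by (auto simp: socle_def)

text \<open>No relation involves the pair (g, s): no quotient of g by a variable is in A, and every
  multiple of s by a variable is.\<close>

lemma tangent_fun_delta:
  assumes "g \<in> min_gens A" "s \<in> socle A"
  shows "tangent_fun A (\<lambda>m b. if m = g \<and> b = s then 1 else 0 :: 'k::zero_neq_one)"
  using assms by (cases g; cases s) (auto simp: tangent_fun_def min_gens_def socle_def)

text \<open>Only multiplication by z leaves b outside A, so the value at (g, b) is passed on to (gz,
  bz) and, bz being a socle monomial, no further. The last two assumptions say that gz divided by x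
  or y leaves A, so (gz, bz) is tied to nothing else.\<close>

lemma tangent_fun_pair:
  assumes "(g1, g2, g3) \<in> min_gens A" "(b1, b2, b3) \<notin> A" "(Suc b1, b2, b3) \<in> A" "(b1, Suc b2, b3) \<in> A"
    "(b1, b2, Suc b3) \<in> socle A"
    "\<And>k. g1 = Suc k \<Longrightarrow> (k, g2, Suc g3) \<notin> A" "\<And>k. g2 = Suc k \<Longrightarrow> (g1, k, Suc g3) \<notin> A"
  shows "tangent_fun A (\<lambda>m b. if m = (g1, g2, g3) \<and> b = (b1, b2, b3) \<or>
    m = (g1, g2, Suc g3) \<and> b = (b1, b2, Suc b3) then 1 else 0 :: 'k::zero_neq_one)"
  using assms by (auto simp: tangent_fun_def min_gens_def socle_def)

lemma dim_tangent_space_expE: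
  fixes I :: "'k::field poly3 set"
  assumes I: "I = mon_ideal (expE (t + 3))"
  shows "vectorspace.fin_dim kk (tangent_space I) \<and> vectorspace.dim kk (tangent_space I)
    \<le> card (min_gens (expE (t + 3))) * card (socle (expE (t + 3))) + 7"
proof -
  let ?A = "expE (t + 3)"
  interpret mon_ideal3 ?A I
    by (intro mon_ideal3.intro mon_ideal3_axioms.intro up_closed_expE I)
  \<comment> \<open>A list makes the bound 7 immediate, since a list has at most as many distinct
    entries as its length.\<close>
  define N :: "((nat \<times> nat \<times> nat) \<times> (nat \<times> nat \<times> nat)) list" where "N = [((1, 2, t), (0, 2, t)), ((1, 2, t), (1, 0, t + 1)), ((1, 2, t), (1, 1, t)),
      ((2, 0, t + 1), (1, 0, t + 1)), ((2, 0, t + 1), (1, 1, t)),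
      ((0, 0, t + 4), (1, 0, t + 1)), ((0, 0, t + 4), (1, 1, t))]"
  let ?P = "min_gens ?A \<times> socle ?A \<union> set N"
  have fin: "finite ?P"
    using finite_min_gens finite_socle[OF finite_compl_expE] by blast
  have "set N \<subseteq> ?A \<times> - ?A" by (simp add: N_def expE_iff)
  then have sub: "?P \<subseteq> ?A \<times> - ?A"
    using min_gens_subset[of ?A] socle_subset[of ?A] by blast
  have "vectorspace.fin_dim kk (tangent_space I) \<and> vectorspace.dim kk (tangent_space I) \<le> card ?P"
  proof (rule dim_tangent_space_le[OF fin sub])
    fix c :: "nat \<times> nat \<times> nat \<Rightarrow> nat \<times> nat \<times> nat \<Rightarrow> 'k"
    assume c: "tangent_fun ?A c" and 0: "\<And>m b. (m, b) \<in> ?P \<Longrightarrow> c m b = 0"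
    interpret tangent_functions_E t c
      by unfold_locales (use c 0 in \<open>auto simp: N_def\<close>)
    have "c (m1, m2, m3) (b1, b2, b3) = 0"
      if "(m1, m2, m3) \<in> ?A" "(b1, b2, b3) \<notin> ?A" for m1 m2 m3 b1 b2 b3
    proof (rule tangent_fun_vanish[OF c _ _ that])
      show "(Suc a, b, e) \<in> ?A \<and> (a, Suc b, e) \<in> ?A \<and> (a, b, Suc e) \<in> ?A" if "(a, b, e) \<in> ?A" for a b e
        using that by (auto simp: expE_iff)
      show "c g b = 0" if "g \<in> min_gens ?A" "b \<notin> ?A" for g b
        using that min_gens_vanish by (cases g; cases b) blast
    qed
    then show "\<forall>m\<in>?A. \<forall>b\<in>- ?A. c m b = 0" by auto
  qed
  moreover have "card ?P \<le> card (min_gens ?A) * card (socle ?A) + 7"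
    by (rule order.trans[OF card_Un_le]) (use card_length[of N] in \<open>simp add: card_cartesian_product N_def\<close>)
  ultimately show ?thesis by linarith
qed

lemma dim_tangent_space_expJ:
  fixes I :: "'k::field poly3 set"
  assumes I: "I = mon_ideal (expJ (t + 3))"
  shows "vectorspace.fin_dim kk (tangent_space I) \<and>
    card (min_gens (expJ (t + 3))) * card (socle (expJ (t + 3))) + 10
    \<le> vectorspace.dim kk (tangent_space I)"
proof -
  let ?A = "expJ (t + 3)"
  interpret mon_ideal3 ?A I
    by (intro mon_ideal3.intro mon_ideal3_axioms.intro up_closed_expJ I)
  have finA: "finite (- ?A)" by (rule finite_compl_expJ)
  \<comment> \<open>This crude determining set provides finite-dimensionality, a prerequisite of the
    lower bound.\<close>
  have "finite (min_gens ?A \<times> - ?A)" using finite_min_gens finA by blast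
  then have "vectorspace.fin_dim kk (tangent_space I) \<and>
      vectorspace.dim kk (tangent_space I) \<le> card (min_gens ?A \<times> - ?A)"
  proof (rule dim_tangent_space_le)
    show "min_gens ?A \<times> - ?A \<subseteq> ?A \<times> - ?A" by (auto simp: min_gens_def)
    fix c :: "nat \<times> nat \<times> nat \<Rightarrow> nat \<times> nat \<times> nat \<Rightarrow> 'k"
    assume c: "tangent_fun ?A c" and 0: "\<And>m b. (m, b) \<in> min_gens ?A \<times> - ?A \<Longrightarrow> c m b = 0"
    have "c (m1, m2, m3) (b1, b2, b3) = 0"
      if "(m1, m2, m3) \<in> ?A" "(b1, b2, b3) \<notin> ?A" for m1 m2 m3 b1 b2 b3
    proof (rule tangent_fun_vanish[OF c _ _ that])
      show "(Suc a, b, e) \<in> ?A \<and> (a, Suc b, e) \<in> ?A \<and> (a, b, Suc e) \<in> ?A" if "(a, b, e) \<in> ?A" for a b e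
        using that by (auto simp: expJ_iff)
      show "c g b = 0" if "g \<in> min_gens ?A" "b \<notin> ?A" for g b using that 0 by blast
    qed
    then show "\<forall>m\<in>?A. \<forall>b\<in>- ?A. c m b = 0" by auto
  qed
  then have fd: "vectorspace.fin_dim kk (tangent_space I)" by blast
  txt \<open>Besides the maps from one generator to one socle monomial there are ten maps, each sending
    \<open>g \<in> N1\<close> to \<open>b \<in> N2\<close> and \<open>g z\<close> to \<open>b z\<close>, the latter a socle monomial.\<close>
  define N1 :: "(nat \<times> nat \<times> nat) set" where "N1 = {(0, 0, t + 5), (0, 1, t + 3), (1, 0, t + 3), (1, 1, t + 1), (2, 0, t + 1)}"
  define N2 :: "(nat \<times> nat \<times> nat) set" where "N2 = {(0, 0, t + 3), (1, 0, t + 1)}"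
  let ?GS = "min_gens ?A \<times> socle ?A"
  let ?Q = "?GS \<union> N1 \<times> N2"
  have fGS: "finite ?GS" using finite_min_gens finite_socle[OF finA] by blast
  have N2: "b \<notin> socle ?A" if "b \<in> N2" for b
    using that by (auto simp: N2_def socle_expJ)
  have N1: "g \<in> min_gens ?A" if "g \<in> N1" for g
    using that by (auto simp: N1_def min_gens_expJ)
  \<comment> \<open>Every first component in \<open>?Q\<close> is a minimal generator, so within
    \<open>?Q\<close> the map \<open>pair x\<close> is nonzero only at x; this gives
    duality.\<close>
  have N1z: "g + (0, 0, 1) \<notin> min_gens ?A" if "g \<in> N1" for g
    using that by (auto simp: N1_def min_gens_expJ)
  define pair :: "_ \<Rightarrow> nat \<times> nat \<times> nat \<Rightarrow> nat \<times> nat \<times> nat \<Rightarrow> 'k" where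
    "pair x = (\<lambda>m b. if m = fst x \<and> b = snd x \<or>
      m = fst x + (0, 0, 1) \<and> b = snd x + (0, 0, 1) then 1 else 0)" for x
  have pair: "tangent_fun ?A (pair (g, b))" if "g \<in> N1" "b \<in> N2" for g b
  proof -
    obtain g1 g2 g3 where g: "g = (g1, g2, g3)" by (rule prod_cases3)
    obtain b1 b2 b3 where b: "b = (b1, b2, b3)" by (rule prod_cases3)
    have 1: "(g1, g2, g3) \<in> min_gens ?A" using N1[OF that(1)] g by simp
    have 2: "(b1, b2, b3) \<notin> ?A" "(Suc b1, b2, b3) \<in> ?A" "(b1, Suc b2, b3) \<in> ?A"
        "(b1, b2, Suc b3) \<in> socle ?A"
      using that(2) by (auto simp: b N2_def expJ_iff socle_expJ)
    have 3: "(k, g2, Suc g3) \<notin> ?A" if "g1 = Suc k" for k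
      using \<open>g \<in> N1\<close> that by (auto simp: g N1_def expJ_iff)
    have 4: "(g1, k, Suc g3) \<notin> ?A" if "g2 = Suc k" for k
      using \<open>g \<in> N1\<close> that by (auto simp: g N1_def expJ_iff)
    have "pair (g, b) = (\<lambda>m b. if m = (g1, g2, g3) \<and> b = (b1, b2, b3) \<or>
        m = (g1, g2, Suc g3) \<and> b = (b1, b2, Suc b3) then 1 else 0)"
      by (simp add: pair_def g b)
    then show ?thesis using tangent_fun_pair[OF 1 2 3 4] by simp
  qed
  define c where "c x = (if x \<in> ?GS then (\<lambda>m b. if m = fst x \<and> b = snd x then 1 else 0) else pair x)" for x
  have "card ?Q \<le> vectorspace.dim kk (tangent_space I)"
  proof (rule card_le_dim_tangent_space[OF fd finA, where c = c])
    show "finite ?Q" using fGS by (simp add: N1_def N2_def)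
    show "?Q \<subseteq> ?A \<times> - ?A"
    proof -
      have "b \<in> - ?A" if "b \<in> N2" for b using that by (auto simp: N2_def expJ_iff)
      then show ?thesis using N1 min_gens_subset[of ?A] socle_subset[of ?A] by blast
    qed
    show "tangent_fun ?A (c x)" if "x \<in> ?Q" for x
    proof (cases "x \<in> ?GS")
      case True
      then show ?thesis
        using tangent_fun_delta[of "fst x" ?A "snd x"] by (simp add: c_def mem_Times_iff)
    next
      case False
      then have "fst x \<in> N1" "snd x \<in> N2" using that by auto
      then show ?thesis using pair[of "fst x" "snd x"] False by (simp add: c_def)
    qed
    show "c x m b = (if (m, b) = x then 1 else 0)" if x: "x \<in> ?Q" and mb: "(m, b) \<in> ?Q" for x m b
    proof (cases "x \<in> ?GS")
      case True
      then show ?thesis by (cases x) (simp add: c_def)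
    next
      case False
      then have n: "fst x \<in> N1" "snd x \<in> N2" using x by auto
      have "m \<in> min_gens ?A" using mb N1 by blast
      then have "m \<noteq> fst x + (0, 0, 1)" using N1z[OF n(1)] by blast
      then show ?thesis using False by (cases x) (simp add: c_def pair_def)
    qed
  qed
  moreover have "card ?Q = card (min_gens ?A) * card (socle ?A) + 10"
  proof -
    have "card N1 = 5" "card N2 = 2" by (simp_all add: N1_def N2_def)
    then have "card (N1 \<times> N2) = 10" by (simp add: card_cartesian_product)
    moreover have "?GS \<inter> N1 \<times> N2 = {}" using N2 by blast
    moreover have "finite (N1 \<times> N2)" by (simp add: N1_def N2_def)
    ultimately show ?thesis using fGS by (simp add: card_Un_disjoint card_cartesian_product)
  qed
  ultimately show ?thesis using fd by simp
qed


section \<open>Identification of \<open>J\<close> and \<open>E(d)\<close>\<close>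

definition up_set :: "(nat \<times> nat \<times> nat) set \<Rightarrow> (nat \<times> nat \<times> nat) set"
  where "up_set M = {u + m |u m. m \<in> M}"

lemma up_closed_up_set: "up_closed (up_set M)"
proof
  fix m u assume "m \<in> up_set M"
  then obtain v n where "m = v + n" "n \<in> M" by (auto simp: up_set_def)
  then have "u + m = (u + v) + n" "n \<in> M" by (simp_all add: add.assoc)
  then show "u + m \<in> up_set M" unfolding up_set_def by blast
qed

text \<open>A monomial has a divisor of every smaller degree: fill up the exponents greedily. It
  selects generators of J that divide a given monomial.\<close>

lemma exists_below:
  assumes "n \<le> a + b + (c :: nat)"
  shows "\<exists>a' b' c'. a' \<le> a \<and> b' \<le> b \<and> c' \<le> c \<and> a' + b' + c' = n"
proof -
  consider "n \<le> a" | "a < n" "n \<le> a + b" | "a + b < n" by linarith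
  then show ?thesis
  proof cases
    case 1
    then show ?thesis by (intro exI[of _ n] exI[of _ 0]) simp
  next
    case 2
    then show ?thesis by (intro exI[of _ a] exI[of _ "n - a"] exI[of _ 0]) simp
  next
    case 3
    then show ?thesis using assms
      by (intro exI[of _ a] exI[of _ b] exI[of _ "n - (a + b)"]) simp
  qed
qed

lemma up_setI:
  assumes "(a', b', c') \<in> M" "a' \<le> a" "b' \<le> b" "c' \<le> c"
  shows "(a, b, c) \<in> up_set M"
proof -
  have "(a, b, c) = (a - a', b - b', c - c') + (a', b', c')" using assms by simp
  then show ?thesis using assms(1) unfolding up_set_def by blast
qed

lemma sum_mem_ideal:
  assumes "ideal3 I" and "\<And>i. i \<in> S \<Longrightarrow> h i \<in> I"
  shows "sum h S \<in> (I :: 'k::field poly3 set)"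
proof -
  interpret ideal3 I by (rule assms)
  show ?thesis using assms(2)
    by (induction S rule: infinite_finite_induct) (auto intro: add_mem)
qed

lemma genideal_monomials:
  "Idl\<^bsub>SS\<^esub> ((\<lambda>m. Poly_Mapping.single m 1) ` M) = (mon_ideal (up_set M) :: 'k::field poly3 set)"
proof
  interpret SS: cring "SS :: 'k poly3 ring" by (rule cring_from_type_algebra)
  let ?G = "(\<lambda>m. Poly_Mapping.single m 1) ` M :: 'k poly3 set"
  have M: "M \<subseteq> up_set M"
  proof
    fix m assume "m \<in> M"
    then have "0 + m \<in> up_set M" unfolding up_set_def by blast
    then show "m \<in> up_set M" by simp
  qed
  show "Idl\<^bsub>SS\<^esub> ?G \<subseteq> mon_ideal (up_set M)"
    by (rule SS.genideal_minimal[OF up_closed.ideal_mon_ideal[OF up_closed_up_set]])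
      (use M in \<open>auto simp: mon_ideal_def\<close>)
  have I: "ideal3 (Idl\<^bsub>SS\<^esub> ?G)"
    by (rule ideal3.intro) (rule SS.genideal_ideal, simp)
  have G: "?G \<subseteq> Idl\<^bsub>SS\<^esub> ?G" by (rule SS.genideal_self) simp
  show "mon_ideal (up_set M) \<subseteq> Idl\<^bsub>SS\<^esub> ?G"
  proof
    fix p :: "'k poly3" assume "p \<in> mon_ideal (up_set M)"
    then have p: "Poly_Mapping.keys p \<subseteq> up_set M" by (simp add: mon_ideal_def)
    have "(\<Sum>m\<in>Poly_Mapping.keys p. Poly_Mapping.single m (Poly_Mapping.lookup p m)) \<in> Idl\<^bsub>SS\<^esub> ?G"
    proof (rule sum_mem_ideal[OF I])
      fix m assume "m \<in> Poly_Mapping.keys p"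
      then obtain u n where m: "m = u + n" "n \<in> M" using p by (auto simp: up_set_def)
      then have "Poly_Mapping.single n 1 \<in> Idl\<^bsub>SS\<^esub> ?G" using G by blast
      then have "Poly_Mapping.single u (Poly_Mapping.lookup p m) * Poly_Mapping.single n 1 \<in> Idl\<^bsub>SS\<^esub> ?G"
        by (rule ideal3.mult_mem[OF I])
      then show "Poly_Mapping.single m (Poly_Mapping.lookup p m) \<in> Idl\<^bsub>SS\<^esub> ?G"
        by (simp add: mult_single m(1))
    qed
    then show "p \<in> Idl\<^bsub>SS\<^esub> ?G" by (simp only: poly3_sum_singles)
  qed
qed

lemma set_add_mon_ideal:
  "mon_ideal A <+>\<^bsub>SS\<^esub> mon_ideal B = (mon_ideal (A \<union> B) :: 'k::field poly3 set)"
proof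
  show "mon_ideal A <+>\<^bsub>SS\<^esub> mon_ideal B \<subseteq> (mon_ideal (A \<union> B) :: 'k poly3 set)"
    by (auto simp: set_add_def' mem_mon_ideal lookup_add)
  show "(mon_ideal (A \<union> B) :: 'k poly3 set) \<subseteq> mon_ideal A <+>\<^bsub>SS\<^esub> mon_ideal B"
  proof
    fix p :: "'k poly3" assume "p \<in> mon_ideal (A \<union> B)"
    then have p: "Poly_Mapping.keys p \<subseteq> A \<union> B" by (simp add: mon_ideal_def)
    let ?s = "\<lambda>m. Poly_Mapping.single m (Poly_Mapping.lookup p m)"
    define q where "q = sum ?s (Poly_Mapping.keys p \<inter> A)"
    define q' where "q' = sum ?s (Poly_Mapping.keys p - A)"
    have "p = q + q'"
      unfolding q_def q'_def
      by (subst poly3_sum_singles[of p, symmetric], subst sum.Int_Diff[of _ _ A]) simp_all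
    moreover have "q \<in> mon_ideal A"
      unfolding q_def mon_ideal_def using keys_sum[of ?s "Poly_Mapping.keys p \<inter> A"]
      by (fastforce split: if_splits)
    moreover have "q' \<in> mon_ideal B"
      unfolding q'_def mon_ideal_def using keys_sum[of ?s "Poly_Mapping.keys p - A"] p
      by (fastforce split: if_splits)
    ultimately show "p \<in> mon_ideal A <+>\<^bsub>SS\<^esub> mon_ideal B"
      unfolding set_add_def' by auto
  qed
qed

definition deg_ge :: "nat \<Rightarrow> (nat \<times> nat \<times> nat) set"
  where "deg_ge n = {(a, b, c). n \<le> a + b + c}"

lemma mm_eq: "mm = (mon_ideal (deg_ge 1) :: 'k::field poly3 set)"
proof -
  let ?M = "{(1, 0, 0), (0, 1, 0), (0, 0, 1)} :: (nat \<times> nat \<times> nat) set"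
  have "up_set ?M = deg_ge 1"
  proof
    show "up_set ?M \<subseteq> deg_ge 1"
    proof
      fix m assume "m \<in> up_set ?M"
      then obtain u n where "m = u + n" "n \<in> ?M" unfolding up_set_def by blast
      then show "m \<in> deg_ge 1" by (cases u) (auto simp: deg_ge_def)
    qed
    show "deg_ge 1 \<subseteq> up_set ?M"
    proof
      fix m assume m: "m \<in> deg_ge 1"
      obtain a b c where abc: "m = (a, b, c)" by (rule prod_cases3)
      have "1 \<le> a + b + c" using m by (simp add: abc deg_ge_def)
      then consider "1 \<le> a" | "1 \<le> b" | "1 \<le> c" by linarith
      then show "m \<in> up_set ?M"
        unfolding abc
        by cases (rule up_setI[of 1 0 0] up_setI[of 0 1 0] up_setI[of 0 0 1]; simp)+
    qed
  qed
  moreover have "{mono3 1 0 0, mono3 0 1 0, mono3 0 0 1} =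
      ((\<lambda>m. Poly_Mapping.single m 1) ` ?M :: 'k poly3 set)"
    by (simp add: mono3_def)
  ultimately show ?thesis by (simp only: mm_def genideal_monomials)
qed

lemma ideal_prod_deg_ge:
  "ideal_prod SS (mon_ideal (deg_ge n)) (mon_ideal (deg_ge 1)) =
    (mon_ideal (deg_ge (n + 1)) :: 'k::field poly3 set)"
proof
  show "ideal_prod SS (mon_ideal (deg_ge n)) (mon_ideal (deg_ge 1)) \<subseteq> (mon_ideal (deg_ge (n + 1)) :: 'k poly3 set)"
  proof
    fix p :: "'k poly3" assume "p \<in> ideal_prod SS (mon_ideal (deg_ge n)) (mon_ideal (deg_ge 1))"
    then show "p \<in> mon_ideal (deg_ge (n + 1))"
    proof (induction rule: ideal_prod.induct)
      case (prod i j)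
      have "u + v \<in> deg_ge (n + 1)" if "u \<in> deg_ge n" "v \<in> deg_ge 1" for u v
        using that by (cases u; cases v) (auto simp: deg_ge_def)
      then show ?case using prod keys_mult[of i j] unfolding mon_ideal_def by force
    next
      case (sum s1 s2)
      then show ?case by (simp add: mem_mon_ideal lookup_add)
    qed
  qed
  show "(mon_ideal (deg_ge (n + 1)) :: 'k poly3 set) \<subseteq> ideal_prod SS (mon_ideal (deg_ge n)) (mon_ideal (deg_ge 1))"
    (is "_ \<subseteq> ?P")
  proof
    fix p :: "'k poly3" assume "p \<in> mon_ideal (deg_ge (n + 1))"
    then have p: "Poly_Mapping.keys p \<subseteq> deg_ge (n + 1)" by (simp add: mon_ideal_def)
    have mult: "q * q' \<in> ?P" if "q \<in> mon_ideal (deg_ge n)" "q' \<in> mon_ideal (deg_ge 1)" for q q'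
      using ideal_prod.prod[OF that, of SS] by simp
    have single: "Poly_Mapping.single m a \<in> ?P" if m: "m \<in> deg_ge (n + 1)" for m a
    proof -
      obtain m1 m2 m3 where mm: "m = (m1, m2, m3)" by (rule prod_cases3)
      consider k where "m1 = Suc k" | k where "m2 = Suc k" | k where "m3 = Suc k"
        using m unfolding mm by (cases m1; cases m2; cases m3) (auto simp: deg_ge_def)
      then obtain u v where uv: "m = u + v" "u \<in> deg_ge n" "v \<in> deg_ge 1"
      proof cases
        case (1 k)
        then show ?thesis using m that[of "(k, m2, m3)" "(1, 0, 0)"] by (simp add: deg_ge_def mm)
      next
        case (2 k)
        then show ?thesis using m that[of "(m1, k, m3)" "(0, 1, 0)"] by (simp add: deg_ge_def mm)
      next
        case (3 k)
        then show ?thesis using m that[of "(m1, m2, k)" "(0, 0, 1)"] by (simp add: deg_ge_def mm)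
      qed
      have "Poly_Mapping.single u a * Poly_Mapping.single v 1 \<in> ?P"
        by (rule mult) (use uv in \<open>auto simp: mon_ideal_def\<close>)
      then show ?thesis by (simp add: mult_single uv(1))
    qed
    have "(\<Sum>m\<in>S. Poly_Mapping.single m (Poly_Mapping.lookup p m)) \<in> ?P"
      if "finite S" "S \<subseteq> deg_ge (n + 1)" for S
      using that
    proof (induction S)
      case empty
      have "(0 :: 'k poly3) * 0 \<in> ?P" by (rule mult) (simp_all add: mem_mon_ideal)
      then show ?case by simp
    next
      case (insert m S)
      then have "Poly_Mapping.single m (Poly_Mapping.lookup p m) \<oplus>\<^bsub>SS\<^esub>
          (\<Sum>m\<in>S. Poly_Mapping.single m (Poly_Mapping.lookup p m)) \<in> ?P"
        by (intro ideal_prod.sum single) auto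
      then show ?case using insert by simp
    qed
    from this[OF finite_keys p] show "p \<in> ?P" by (simp only: poly3_sum_singles)
  qed
qed

lemma mm_pow: "mm [^]\<^bsub>ideals_set SS\<^esub> n = (mon_ideal (deg_ge n) :: 'k::field poly3 set)"
proof (induction n)
  case 0
  \<comment> \<open>The unit of the monoid of ideals is S itself, matching the vacuous degree
    bound.\<close>
  have "mon_ideal (deg_ge 0) = (UNIV :: 'k poly3 set)"
    by (auto simp: mon_ideal_def deg_ge_def)
  then show ?case by (simp add: nat_pow_def ideals_set_def)
next
  case (Suc n)
  have "mm [^]\<^bsub>ideals_set SS\<^esub> Suc n = ideal_prod SS (mm [^]\<^bsub>ideals_set SS\<^esub> n) (mm :: 'k poly3 set)"
    by (simp add: nat_pow_def ideals_set_def)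
  then show ?case using Suc ideal_prod_deg_ge[of n] by (simp add: mm_eq)
qed

lemma hilb3_mon_ideal:
  assumes "up_closed A" "finite (- A)"
  shows "(mon_ideal A :: 'k::field poly3 set) \<in> hilb3 d \<longleftrightarrow> card (- A) = d"
proof -
  interpret mon_ideal3 A "mon_ideal A :: 'k poly3 set"
    by (intro mon_ideal3.intro mon_ideal3_axioms.intro assms(1) refl)
  show ?thesis
    using dim_quot_space[OF assms(2)] ideal by (auto simp: hilb3_def)
qed

section \<open>Lexsegment ideals and the ideal E(d)\<close>

definition lexseg_exps :: "nat \<Rightarrow> (nat \<times> nat \<times> nat) set \<Rightarrow> (nat \<times> nat \<times> nat) set"
  where "lexseg_exps s K = K \<union> deg_ge (s + 1)"

text \<open>A proper multiple of a monomial of degree s has degree at least s + 1, so K together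
  with all higher degrees is already closed upwards.\<close>

lemma
  assumes "lex_initial s K"
  shows up_closed_lexseg_exps: "up_closed (lexseg_exps s K)"
    and finite_compl_lexseg_exps: "finite (- lexseg_exps s K)"
    and up_set_lexseg_exps: "up_set K \<union> deg_ge (s + 1) = lexseg_exps s K"
proof -
  have K: "K \<subseteq> exps3 s" using assms by (simp add: lex_initial_def)
  have step: "u = 0 \<or> u + m \<in> deg_ge (s + 1)" if "m \<in> exps3 s" for u m
  proof (cases u)
    case (fields a b c)
    then show ?thesis using that
      by (cases m) (auto simp: exps3_def deg_ge_def zero_prod_def)
  qed
  have step': "u + m \<in> deg_ge n" if "m \<in> deg_ge n" for u m n
    using that by (cases u; cases m) (auto simp: deg_ge_def)
  have KK: "u + m \<in> lexseg_exps s K" if "m \<in> K" for u m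
    using step[of m u] that K by (auto simp: lexseg_exps_def)
  show "up_closed (lexseg_exps s K)"
  proof
    fix m u assume "m \<in> lexseg_exps s K"
    then show "u + m \<in> lexseg_exps s K"
      using KK step' unfolding lexseg_exps_def by blast
  qed
  show "finite (- lexseg_exps s K)"
    by (rule finite_subset[OF _ finite_exps_le[of s]]) (auto simp: lexseg_exps_def deg_ge_def)
  have "K \<subseteq> up_set K"
  proof
    fix m assume "m \<in> K"
    then have "0 + m \<in> up_set K" unfolding up_set_def by blast
    then show "m \<in> up_set K" by simp
  qed
  moreover have "up_set K \<subseteq> lexseg_exps s K" using KK by (auto simp: up_set_def)
  ultimately show "up_set K \<union> deg_ge (s + 1) = lexseg_exps s K"
    by (auto simp: lexseg_exps_def)
qed

lemma lexseg_ideal_iff: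
  "lexseg_ideal (E :: 'k::field poly3 set) \<longleftrightarrow>
    (\<exists>s K. lex_initial s K \<and> E = mon_ideal (lexseg_exps s K))"
proof -
  have gen: "{mono3 a b c |a b c. (a, b, c) \<in> K} = ((\<lambda>m. Poly_Mapping.single m 1) ` K :: 'k poly3 set)" for K
    by (force simp: mono3_def)
  show ?thesis
    unfolding lexseg_ideal_def gen genideal_monomials mm_pow set_add_mon_ideal
    using up_set_lexseg_exps by metis
qed

text \<open>Lexsegment ideals form a chain: a larger s gives a smaller ideal, and for equal s two
  initial segments of a total order are comparable.\<close>

lemma lexseg_exps_nested:
  assumes "lex_initial s K" "lex_initial s' K'"
  shows "lexseg_exps s K \<subseteq> lexseg_exps s' K' \<or> lexseg_exps s' K' \<subseteq> lexseg_exps s K"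
proof -
  have lt: "lexseg_exps s' K' \<subseteq> lexseg_exps s K" if "lex_initial s' K'" "s < s'" for s s' K K'
    using that by (fastforce simp: lexseg_exps_def lex_initial_def exps3_def deg_ge_def)
  have tot: "m = m' \<or> (m, m') \<in> lex3 \<or> (m', m) \<in> lex3" for m m'
    by (cases m; cases m') (auto simp: lex3_def)
  have "K \<subseteq> K' \<or> K' \<subseteq> K" if "s = s'"
  proof (rule ccontr)
    assume "\<not> (K \<subseteq> K' \<or> K' \<subseteq> K)"
    then obtain m m' where m: "m \<in> K" "m \<notin> K'" "m' \<in> K'" "m' \<notin> K" by blast
    then show False
      using tot[of m m'] assms that unfolding lex_initial_def by blast
  qed
  then show ?thesis
    using lt[OF assms(1), of s' K'] lt[OF assms(2), of s K] nat_neq_iff[of s s']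
    by (auto simp: lexseg_exps_def)
qed

text \<open>In a chain, equal finite colength forces equality, which is the uniqueness behind
  \<open>THE\<close>. Exponent sets are compared rather than pairs (s, K), because an empty K at s
  and all monomials at s + 1 give the same ideal.\<close>

lemma EE_eq:
  assumes K: "lex_initial s K" and d: "card (- lexseg_exps s K) = d"
  shows "EE d = (mon_ideal (lexseg_exps s K) :: 'k::field poly3 set)"
  unfolding EE_def
proof (rule the_equality)
  show "lexseg_ideal (mon_ideal (lexseg_exps s K) :: 'k poly3 set) \<and>
      (mon_ideal (lexseg_exps s K) :: 'k poly3 set) \<in> hilb3 d"
    using K d hilb3_mon_ideal[OF up_closed_lexseg_exps[OF K] finite_compl_lexseg_exps[OF K]]
    by (auto simp: lexseg_ideal_iff)
next
  fix E :: "'k poly3 set" assume "lexseg_ideal E \<and> E \<in> hilb3 d"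
  then obtain s' K' where K': "lex_initial s' K'" and E: "E = mon_ideal (lexseg_exps s' K')"
    and h: "E \<in> hilb3 d"
    by (auto simp: lexseg_ideal_iff)
  have d': "card (- lexseg_exps s' K') = d"
    using h hilb3_mon_ideal[OF up_closed_lexseg_exps[OF K'] finite_compl_lexseg_exps[OF K']] E by auto
  have "- lexseg_exps s K = - lexseg_exps s' K'"
    using lexseg_exps_nested[OF K K']
  proof
    assume "lexseg_exps s K \<subseteq> lexseg_exps s' K'"
    then show ?thesis
      using card_subset_eq[OF finite_compl_lexseg_exps[OF K], of "- lexseg_exps s' K'"] d d' by auto
  next
    assume "lexseg_exps s' K' \<subseteq> lexseg_exps s K"
    then show ?thesis
      using card_subset_eq[OF finite_compl_lexseg_exps[OF K'], of "- lexseg_exps s K"] d d' by auto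
  qed
  then show "E = mon_ideal (lexseg_exps s K)" using E by simp
qed

lemma EE_eq_mon_ideal: "EE (((t + 5) choose 3) + t + 6) = (mon_ideal (expE (t + 3)) :: 'k::field poly3 set)"
proof -
  define K where "K = {(a, b, c). a + b + c = t + 3 \<and> (2 \<le> a \<or> a = 1 \<and> 2 \<le> b)}"
  have K: "lex_initial (t + 3) K"
    by (auto simp: lex_initial_def K_def exps3_def lex3_def)
  have E: "lexseg_exps (t + 3) K = expE (t + 3)"
    by (auto simp: lexseg_exps_def K_def deg_ge_def expE_def)
  show ?thesis using EE_eq[OF K, where ?'k = 'k] card_compl(1)[of t] by (simp add: E)
qed

lemma JJ_eq_mon_ideal: "JJ (t + 3) = (mon_ideal (expJ (t + 3)) :: 'k::field poly3 set)"
proof -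
  define M1 where "M1 = {(2 + a, b, c) |a b c. a + b + c = t + 1}"
  define M2 where "M2 = {(1 :: nat, 1 + b, c) |b c. b + c = t + 1}"
  define M3 where "M3 = {(1 :: nat, 0 :: nat, t + 3)}"
  define M4 where "M4 = {(0 :: nat, 1 + b, c) |b c. b + c = t + 3}"
  define M5 where "M5 = {(0 :: nat, 0 :: nat, t + 5)}"
  let ?s = "\<lambda>m. Poly_Mapping.single m 1 :: 'k poly3"
  have M: "{mono3 2 0 0 * mono3 a b c |a b c. a + b + c = t + 1} = ?s ` M1"
    "{mono3 1 1 0 * mono3 0 b c |b c. b + c = t + 1} = ?s ` M2"
    "{mono3 1 0 (t + 3)} = ?s ` M3"
    "{mono3 0 1 0 * mono3 0 b c |b c. b + c = t + 3} = ?s ` M4"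
    "{mono3 0 0 (t + 5)} = ?s ` M5"
    by (auto simp: mono3_def mult_single M1_def M2_def M3_def M4_def M5_def image_iff)
  let ?U = "up_set M1 \<union> up_set M2 \<union> up_set M3 \<union> up_set M4 \<union> up_set M5"
  have eq: "t + 3 - 2 = t + 1" "t + 3 + 2 = t + 5" by simp_all
  have "JJ (t + 3) = (mon_ideal ?U :: 'k poly3 set)"
    unfolding JJ_def eq M genideal_monomials set_add_mon_ideal ..
  moreover have "?U = expJ (t + 3)"
  proof
    have sub: "up_set N \<subseteq> expJ (t + 3)" if "N \<subseteq> expJ (t + 3)" for N
      using that up_closed.up[OF up_closed_expJ] by (auto simp: up_set_def)
    show "?U \<subseteq> expJ (t + 3)"
      by (intro Un_least sub) (auto simp: M1_def M2_def M3_def M4_def M5_def expJ_def)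
    show "expJ (t + 3) \<subseteq> ?U"
    proof
      fix m assume m: "m \<in> expJ (t + 3)"
      obtain a b c where abc: "m = (a, b, c)" by (rule prod_cases3)
      \<comment> \<open>Splitting by the exponents of x and y matches the five cases with the five
        summands of J, in order.\<close>
      consider "2 \<le> a" "t + 3 \<le> a + b + c" | "a = 1" "1 \<le> b" "t + 3 \<le> a + b + c"
        | "a = 1" "b = 0" "t + 3 \<le> c" | "a = 0" "1 \<le> b" "t + 4 \<le> b + c" | "a = 0" "b = 0" "t + 5 \<le> c"
        using m unfolding abc expJ_iff by linarith
      then show "m \<in> ?U"
      proof cases
        case 1
        then have "t + 1 \<le> a - 2 + b + c" by linarith
        then obtain a' b' c' where "a' \<le> a - 2" "b' \<le> b" "c' \<le> c" "a' + b' + c' = t + 1"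
          using exists_below[of "t + 1" "a - 2" b c] by blast
        then have "(2 + a', b', c') \<in> M1" "2 + a' \<le> a" "b' \<le> b" "c' \<le> c"
          using 1 by (auto simp: M1_def)
        then show ?thesis using up_setI abc by blast
      next
        case 2
        then have "t + 1 \<le> 0 + (b - 1) + c" by linarith
        then obtain a' b' c' where "a' \<le> 0" "b' \<le> b - 1" "c' \<le> c" "a' + b' + c' = t + 1"
          using exists_below[of "t + 1" 0 "b - 1" c] by blast
        then have "(1, 1 + b', c') \<in> M2" "1 \<le> a" "1 + b' \<le> b" "c' \<le> c"
          using 2 by (auto simp: M2_def)
        then show ?thesis using up_setI abc by blast
      next
        case 3
        then have "(1, 0, t + 3) \<in> M3" "1 \<le> a" "0 \<le> b" "t + 3 \<le> c" by (auto simp: M3_def)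
        then show ?thesis using up_setI abc by blast
      next
        case 4
        then have "t + 3 \<le> 0 + (b - 1) + c" by linarith
        then obtain a' b' c' where "a' \<le> 0" "b' \<le> b - 1" "c' \<le> c" "a' + b' + c' = t + 3"
          using exists_below[of "t + 3" 0 "b - 1" c] by blast
        then have "(0, 1 + b', c') \<in> M4" "0 \<le> a" "1 + b' \<le> b" "c' \<le> c"
          using 4 by (auto simp: M4_def)
        then show ?thesis using up_setI abc by blast
      next
        case 5
        then have "(0, 0, t + 5) \<in> M5" "0 \<le> a" "0 \<le> b" "t + 5 \<le> c" by (auto simp: M5_def)
        then show ?thesis using up_setI abc by blast
      qed
    qed
  qed
  ultimately show ?thesis by simp
qed

theorem theorem5p2:
  fixes r d :: nat
  assumes "infinite (UNIV :: 'k::field set)"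
    and "r \<ge> 3"
    and "d = ((r + 2) choose 3) + r + 3"
  shows "(JJ r :: 'k poly3 set) \<in> hilb3 d
    \<and> vectorspace.fin_dim kk (tangent_space (JJ r :: 'k poly3 set))
    \<and> vectorspace.fin_dim kk (tangent_space (EE d :: 'k poly3 set))
    \<and> vectorspace.dim kk (tangent_space (JJ r :: 'k poly3 set))
      > vectorspace.dim kk (tangent_space (EE d :: 'k poly3 set))"
proof -
  obtain t where r: "r = t + 3" using assms(2) by (metis le_add_diff_inverse2)
  have "r + 2 = t + 5" using r by simp
  from assms(3)[unfolded this] have d: "d = ((t + 5) choose 3) + t + 6" using r by linarith
  have J: "(JJ r :: 'k poly3 set) = mon_ideal (expJ (t + 3))"
    unfolding r by (rule JJ_eq_mon_ideal)
  have E: "(EE d :: 'k poly3 set) = mon_ideal (expE (t + 3))"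
    unfolding d by (rule EE_eq_mon_ideal)
  have "(JJ r :: 'k poly3 set) \<in> hilb3 d"
    unfolding J using hilb3_mon_ideal[OF up_closed_expJ finite_compl_expJ] card_compl(2) d by blast
  then show ?thesis
    using dim_tangent_space_expJ[OF J] dim_tangent_space_expE[OF E] card_min_gens[of t] card_socle[of t]
    by simp
qed


end
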